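(* At least $10$ of the $7050$ triangulations (up to isomorphism) with exactly $10$ vertices of the non-orientable closed surface $N_5$ of genus $5$ admit polyhedral realizations in $\mathbb{R}^3$; moreover, at least $10$ of them admit polyhedral realizations in $\mathbb{R}^3$ possessing a $3$-fold rotational symmetry.
   Context: $N_h$ denotes the connected sum of $h$ projective planes (the non-orientable closed surface of genus $h$). A triangulation of a closed connected surface $S$ is a finite two-dimensional simplicial complex $\Delta$ whose underlying space $|\Delta|$ is homeomorphic to $S$; triangulations are counted up to combinatorial (simplicial) isomorphism. There are exactly $7050$ triangulations of $N_5$ with $10$ vertices, from the known enumeration. Let $V$ be the vertex set of $\Delta$. Each map $\psi\colon V\to\mathbb{R}^3$ induces a simplexwise linear map $\phi_\psi\colon|\Delta|\to\mathbb{R}^3$. Since the surface is non-orientable, a polyhedral realization of $\Delta$ in $\mathbb{R}^3$ is a map $\phi_\psi$ that is locally injective (a simplexwise linear immersion). A geometric symmetry of a polyhedral realization $\phi_\psi$ is an isometry $g$ of $\mathbb{R}^3$ that maps $\phi_\psi(|\Delta|)$ to itself and is induced by an automorphism $\alpha$ of $\Delta$, i.e. $g\circ\phi_\psi=\phi_\psi\circ|\alpha|$. The realization has $3$-fold rotational symmetry if a rotation of order $3$ about a line is a geometric symmetry of it, induced by a nontrivial automorphism. *)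

theory Defs
  imports "HOL-Analysis.Analysis"
begin

subsection \<open>The surfaces \<open>N\<^sub>h\<close>\<close>

definition projective_plane :: "'a topology \<Rightarrow> bool" where
  "projective_plane P \<longleftrightarrow>
     (\<exists>q. quotient_map (top_of_set (sphere (0::real^3) 1)) P q \<and>
          (\<forall>x\<in>sphere 0 1. \<forall>y\<in>sphere 0 1. q x = q y \<longleftrightarrow> x = y \<or> x = - y))"

text \<open>
  \<open>Z\<close> arises from surfaces \<open>X\<close> and \<open>Y\<close> by removing the interiors of the embedded closed discs
  \<open>d\<close> and \<open>e\<close> and gluing what remains along the boundary circles.  No separate gluing
  homeomorphism of the circles is needed: it extends radially over the disc and so can be
  absorbed into the parametrization \<open>e\<close>.
\<close>

definition connected_sum :: "'a topology \<Rightarrow> 'a topology \<Rightarrow> 'a topology \<Rightarrow> bool" where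
  "connected_sum X Y Z \<longleftrightarrow>
     (\<exists>(d :: complex \<Rightarrow> 'a) (e :: complex \<Rightarrow> 'a) (q :: bool \<times> 'a \<Rightarrow> 'a).
        embedding_map (top_of_set (cball 0 1)) X d \<and> openin X (d ` ball 0 1) \<and>
        embedding_map (top_of_set (cball 0 1)) Y e \<and> openin Y (e ` ball 0 1) \<and>
        (let W = sum_topology
                   (\<lambda>b. if b then subtopology Y (topspace Y - e ` ball 0 1)
                        else subtopology X (topspace X - d ` ball 0 1)) UNIV
         in quotient_map W Z q \<and>
            (\<forall>s\<in>topspace W. \<forall>t\<in>topspace W.
               q s = q t \<longleftrightarrow> s = t \<or> (\<exists>z\<in>sphere 0 1. {s, t} = {(False, d z), (True, e z)}))))"

text \<open>
  \<open>nonorientable_surface h S\<close>: \<open>S\<close> is a connected sum of \<open>h \<ge> 1\<close> projective planes.  Up to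
  homeomorphism \<open>S\<close> does not depend on the discs chosen.  The carrier type has to contain copies
  of all surfaces that occur; any type of cardinality at least the continuum will do.
\<close>

inductive nonorientable_surface :: "nat \<Rightarrow> 'a topology \<Rightarrow> bool" where
  one: "projective_plane P \<Longrightarrow> nonorientable_surface 1 P"
| step: "nonorientable_surface h S \<Longrightarrow> projective_plane P \<Longrightarrow> connected_sum S P S' \<Longrightarrow>
         nonorientable_surface (Suc h) S'"


subsection \<open>Simplicial complexes\<close>

text \<open>Complexes are given abstractly, by the set of vertex sets of their nonempty simplices.\<close>

definition abstract_complex :: "'v set set \<Rightarrow> bool" where
  "abstract_complex K \<longleftrightarrow>
     finite K \<and> (\<forall>\<sigma>\<in>K. finite \<sigma> \<and> \<sigma> \<noteq> {}) \<and>
     (\<forall>\<sigma>\<in>K. \<forall>\<tau>. \<tau> \<noteq> {} \<and> \<tau> \<subseteq> \<sigma> \<longrightarrow> \<tau> \<in> K)"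

definition two_dimensional :: "'v set set \<Rightarrow> bool" where
  "two_dimensional K \<longleftrightarrow> (\<forall>\<sigma>\<in>K. card \<sigma> \<le> 3) \<and> (\<exists>\<sigma>\<in>K. card \<sigma> = 3)"

definition vertices :: "'v set set \<Rightarrow> 'v set" where
  "vertices K = \<Union>K"

text \<open>
  The underlying space, in barycentric coordinates.  Its topology is the one induced from the
  product topology on functions, which for finite complexes is the usual one.
\<close>

definition underlying_space :: "'v set set \<Rightarrow> ('v \<Rightarrow> real) set" where
  "underlying_space K =
     {x. (\<forall>v. 0 \<le> x v) \<and> {v. x v \<noteq> 0} \<in> K \<and> (\<Sum>v\<in>vertices K. x v) = 1}"

definition simplicial_iso :: "('v \<Rightarrow> 'w) \<Rightarrow> 'v set set \<Rightarrow> 'w set set \<Rightarrow> bool" where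
  "simplicial_iso f K L \<longleftrightarrow> bij_betw f (vertices K) (vertices L) \<and> (\<lambda>\<sigma>. f ` \<sigma>) ` K = L"

definition simplicially_isomorphic :: "'v set set \<Rightarrow> 'w set set \<Rightarrow> bool" where
  "simplicially_isomorphic K L \<longleftrightarrow> (\<exists>f. simplicial_iso f K L)"

text \<open>The map \<open>|\<alpha>|\<close> of underlying spaces extending a vertex map \<open>\<alpha>\<close> linearly on each simplex.\<close>

definition induced_map :: "'v set set \<Rightarrow> ('v \<Rightarrow> 'w) \<Rightarrow> ('v \<Rightarrow> real) \<Rightarrow> ('w \<Rightarrow> real)" where
  "induced_map K \<alpha> x = (\<lambda>w. \<Sum>v\<in>{v \<in> vertices K. \<alpha> v = w}. x v)"

definition triangulates :: "'v set set \<Rightarrow> 'a topology \<Rightarrow> bool" where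
  "triangulates K S \<longleftrightarrow>
     abstract_complex K \<and> two_dimensional K \<and>
     top_of_set (underlying_space K) homeomorphic_space S"

definition triangulation_of_N :: "nat \<Rightarrow> 'v set set \<Rightarrow> bool" where
  "triangulation_of_N h K \<longleftrightarrow>
     (\<exists>S :: (nat \<Rightarrow> real) topology. nonorientable_surface h S \<and> triangulates K S)"


subsection \<open>Polyhedral realizations and their symmetries\<close>

text \<open>The simplexwise linear map \<open>\<phi>\<^sub>\<psi>\<close>; values of \<open>\<psi>\<close> outside the vertex set are irrelevant.\<close>

definition simplexwise_linear :: "'v set set \<Rightarrow> ('v \<Rightarrow> real^3) \<Rightarrow> ('v \<Rightarrow> real) \<Rightarrow> real^3" where
  "simplexwise_linear K \<psi> x = (\<Sum>v\<in>vertices K. x v *\<^sub>R \<psi> v)"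

definition locally_injective_on ::
    "('a::topological_space \<Rightarrow> 'b) \<Rightarrow> 'a set \<Rightarrow> bool" where
  "locally_injective_on f A \<longleftrightarrow> (\<forall>x\<in>A. \<exists>U. open U \<and> x \<in> U \<and> inj_on f (U \<inter> A))"

text \<open>Polyhedral realization of a triangulated non-orientable surface (immersed, not embedded).\<close>

definition polyhedral_realization :: "'v set set \<Rightarrow> ('v \<Rightarrow> real^3) \<Rightarrow> bool" where
  "polyhedral_realization K \<psi> \<longleftrightarrow>
     locally_injective_on (simplexwise_linear K \<psi>) (underlying_space K)"

definition geometric_symmetry ::
    "'v set set \<Rightarrow> ('v \<Rightarrow> real^3) \<Rightarrow> (real^3 \<Rightarrow> real^3) \<Rightarrow> ('v \<Rightarrow> 'v) \<Rightarrow> bool" where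
  "geometric_symmetry K \<psi> g \<alpha> \<longleftrightarrow>
     (\<forall>x y. dist (g x) (g y) = dist x y) \<and>
     g ` simplexwise_linear K \<psi> ` underlying_space K
       = simplexwise_linear K \<psi> ` underlying_space K \<and>
     simplicial_iso \<alpha> K K \<and>
     (\<forall>x\<in>underlying_space K.
        g (simplexwise_linear K \<psi> x) = simplexwise_linear K \<psi> (induced_map K \<alpha> x))"

text \<open>Rotation about the line through \<open>p\<close> with direction \<open>u\<close>.\<close>

definition rotation_about_line :: "real^3 \<Rightarrow> real^3 \<Rightarrow> (real^3 \<Rightarrow> real^3) \<Rightarrow> bool" where
  "rotation_about_line p u g \<longleftrightarrow>
     u \<noteq> 0 \<and> (\<exists>A :: real^3^3. rotation_matrix A \<and> A *v u = u \<and> (\<forall>x. g x = p + A *v (x - p)))"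

definition threefold_rotational_symmetry :: "'v set set \<Rightarrow> ('v \<Rightarrow> real^3) \<Rightarrow> bool" where
  "threefold_rotational_symmetry K \<psi> \<longleftrightarrow>
     (\<exists>p u g \<alpha>. rotation_about_line p u g \<and> g \<noteq> id \<and> g \<circ> g \<circ> g = id \<and>
        geometric_symmetry K \<psi> g \<alpha> \<and> (\<exists>v\<in>vertices K. \<alpha> v \<noteq> v))"

end

theory Submission
  imports Defs "HOL-Library.Code_Binary_Nat"
begin

text \<open>
  The ten triangulations are the \<open>10\<close>-vertex triangulations of \<open>N\<^sub>5\<close> with an automorphism of order
  \<open>3\<close> for which a computer search finds an immersion with integer vertex positions that is equivariant
  for the cyclic permutation of the coordinates.

  A simplexwise linear map is locally injective iff it is injective on the open star of each vertex
  \<open>v\<close>.  There this is a condition on pairs of triangles at \<open>v\<close>: the cones that they span at \<open>v\<close> must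
  intersect only in the cone of their common face, which follows from signs of determinants.

  To recognize the surfaces, note that a bistellar move changes the underlying space by an explicit
  piecewise linear homeomorphism.  Dividing the subdivided octahedron by the antipodal map gives a
  triangulated projective plane, which moves reduce to \<open>6\<close> vertices.  Gluing complexes along a
  triangle and removing its interior is a connected sum, with the second projection from the
  disjoint union as quotient map.  Five copies of the projective plane are glued, moves remove the
  superfluous vertices, and further edge flips lead through all ten triangulations.
\<close>

section \<open>Complexes spanned by facets\<close>

text \<open>\<open>nonorientable_surface\<close> asks for actual quotient maps, so the surfaces are
  not recognized by Euler characteristic and nonorientability: a chain of explicit homeomorphisms
  ties each of them to connected sums of projective planes. Counting up to isomorphism also needs a
  reason why the ten complexes differ; this is a number computed from vertex degrees. The cyclic
  permutation of the coordinates is a rotation of order three with an integer matrix, so symmetric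
  realizations can have integer vertices and every test is an exact computation with integers. In
  each realization the ten vertices form three orbits of size three and one fixed vertex, which must
  lie on the axis and is placed at the origin. The checks on lists of triangles are certificates:
  they are sound, and a refusal proves nothing.\<close>

definition complex_of :: "'v set set \<Rightarrow> 'v set set" where
  "complex_of F = {\<sigma>. \<sigma> \<noteq> {} \<and> (\<exists>t\<in>F. \<sigma> \<subseteq> t)}"

lemma complex_ofI: "\<sigma> \<noteq> {} \<Longrightarrow> t \<in> F \<Longrightarrow> \<sigma> \<subseteq> t \<Longrightarrow> \<sigma> \<in> complex_of F"
  by (auto simp: complex_of_def)

lemma complex_ofE:
  assumes "\<sigma> \<in> complex_of F"
  obtains t where "t \<in> F" "\<sigma> \<subseteq> t" "\<sigma> \<noteq> {}"
  using assms by (auto simp: complex_of_def)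

lemma abstract_complex_of:
  assumes "finite F" "\<And>t. t \<in> F \<Longrightarrow> finite t"
  shows "abstract_complex (complex_of F)"
proof -
  have "complex_of F \<subseteq> (\<Union>t\<in>F. Pow t)"
    by (auto simp: complex_of_def)
  moreover have "finite (\<Union>t\<in>F. Pow t)"
    using assms by auto
  ultimately have "finite (complex_of F)"
    by (rule finite_subset)
  moreover have "finite \<sigma>" if "\<sigma> \<in> complex_of F" for \<sigma>
    using that assms by (auto simp: complex_of_def intro: finite_subset)
  moreover have "\<tau> \<in> complex_of F" if "\<sigma> \<in> complex_of F" "\<tau> \<noteq> {}" "\<tau> \<subseteq> \<sigma>" for \<sigma> \<tau>
    using that by (meson complex_ofE complex_ofI order_trans)
  moreover have "\<sigma> \<noteq> {}" if "\<sigma> \<in> complex_of F" for \<sigma>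
    using that by (auto simp: complex_of_def)
  ultimately show ?thesis
    unfolding abstract_complex_def by blast
qed

lemma abstract_complexD:
  assumes "abstract_complex K"
  shows "finite K" "finite (vertices K)" "\<sigma> \<in> K \<Longrightarrow> finite \<sigma>" "\<sigma> \<in> K \<Longrightarrow> \<sigma> \<noteq> {}"
    "\<sigma> \<in> K \<Longrightarrow> \<tau> \<noteq> {} \<Longrightarrow> \<tau> \<subseteq> \<sigma> \<Longrightarrow> \<tau> \<in> K" "\<sigma> \<in> K \<Longrightarrow> \<sigma> \<subseteq> vertices K"
proof -
  have K: "finite K" "\<forall>\<sigma>\<in>K. finite \<sigma> \<and> \<sigma> \<noteq> {}"
    "\<forall>\<sigma>\<in>K. \<forall>\<tau>. \<tau> \<noteq> {} \<and> \<tau> \<subseteq> \<sigma> \<longrightarrow> \<tau> \<in> K"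
    using assms unfolding abstract_complex_def by blast+
  show "finite K" "\<sigma> \<in> K \<Longrightarrow> finite \<sigma>" "\<sigma> \<in> K \<Longrightarrow> \<sigma> \<noteq> {}" using K by blast+
  show "finite (vertices K)" unfolding vertices_def using K by (intro finite_Union) blast+
  show "\<sigma> \<in> K \<Longrightarrow> \<tau> \<noteq> {} \<Longrightarrow> \<tau> \<subseteq> \<sigma> \<Longrightarrow> \<tau> \<in> K" using K(3) by blast
  show "\<sigma> \<in> K \<Longrightarrow> \<sigma> \<subseteq> vertices K" by (auto simp: vertices_def)
qed

text \<open>The definition sums over \<open>vertices K\<close>, a set that changes when a move
  creates or removes a vertex. Any finite set containing the support gives the same sum, so points
  of two complexes can be compared over one common set.\<close>

lemma underlying_space_iff:
  assumes K: "abstract_complex K" and V: "finite V" "{v. x v \<noteq> 0} \<subseteq> V"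
  shows "x \<in> underlying_space K \<longleftrightarrow> (\<forall>v. 0 \<le> x v) \<and> {v. x v \<noteq> 0} \<in> K \<and> sum x V = 1"
proof -
  have "sum x (vertices K) = sum x V" if s: "{v. x v \<noteq> 0} \<in> K"
  proof -
    have "sum x V = sum x {v. x v \<noteq> 0}"
      using V by (intro sum.mono_neutral_right) auto
    moreover have "sum x (vertices K) = sum x {v. x v \<noteq> 0}"
      using abstract_complexD(2)[OF K] abstract_complexD(6)[OF K s] by (intro sum.mono_neutral_right) auto
    ultimately show ?thesis by simp
  qed
  then show ?thesis
    by (auto simp: underlying_space_def)
qed

lemma underlying_spaceD:
  assumes "abstract_complex K" "x \<in> underlying_space K"
  shows "0 \<le> x v" "{v. x v \<noteq> 0} \<in> K" "finite {v. x v \<noteq> 0}" "sum x {v. x v \<noteq> 0} = 1"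
proof -
  show *: "0 \<le> x v" "{v. x v \<noteq> 0} \<in> K"
    using assms(2) by (auto simp: underlying_space_def)
  show "finite {v. x v \<noteq> 0}"
    using * abstract_complexD(3)[OF assms(1)] by blast
  then show "sum x {v. x v \<noteq> 0} = 1"
    using underlying_space_iff[OF assms(1), of "{v. x v \<noteq> 0}" x] assms(2) by auto
qed

lemma homeomorphic_spaceI_top_of_set:
  assumes "continuous_on S f" "continuous_on T g"
    "\<And>x. x \<in> S \<Longrightarrow> f x \<in> T \<and> g (f x) = x" "\<And>y. y \<in> T \<Longrightarrow> g y \<in> S \<and> f (g y) = y"
  shows "top_of_set S homeomorphic_space top_of_set T"
  unfolding homeomorphic_space_def homeomorphic_maps_def using assms by (intro exI[of _ f] exI[of _ g]) auto

section \<open>Bistellar moves\<close>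

text \<open>A bistellar move: the join of A with the boundary of B is replaced by the join of the
  boundary of A with B, and all other faces are kept. On a surface A and B have four vertices
  together; the sizes (3,1), (2,2) and (1,3) are the subdivision of a triangle, an edge flip and the
  removal of a vertex of degree three.\<close>

definition exchange :: "'v set \<Rightarrow> 'v set \<Rightarrow> 'v set set \<Rightarrow> 'v set set \<Rightarrow> bool" where
  "exchange A B K L \<longleftrightarrow> finite A \<and> finite B \<and> A \<noteq> {} \<and> B \<noteq> {} \<and> A \<inter> B = {} \<and>
     (\<forall>\<sigma>. A \<subseteq> \<sigma> \<longrightarrow> (\<sigma> \<in> K \<longleftrightarrow> \<sigma> \<subset> A \<union> B) \<and> \<sigma> \<notin> L) \<and>
     (\<forall>\<sigma>. B \<subseteq> \<sigma> \<longrightarrow> (\<sigma> \<in> L \<longleftrightarrow> \<sigma> \<subset> A \<union> B) \<and> \<sigma> \<notin> K) \<and>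
     (\<forall>\<sigma>. \<not> A \<subseteq> \<sigma> \<longrightarrow> \<not> B \<subseteq> \<sigma> \<longrightarrow> (\<sigma> \<in> K \<longleftrightarrow> \<sigma> \<in> L))"

lemma exchangeD:
  assumes "exchange A B K L"
  shows "finite A" "finite B" "A \<noteq> {}" "B \<noteq> {}" "A \<inter> B = {}"
    and "A \<subseteq> \<sigma> \<Longrightarrow> \<sigma> \<in> K \<longleftrightarrow> \<sigma> \<subset> A \<union> B" "B \<subseteq> \<sigma> \<Longrightarrow> \<sigma> \<in> L \<longleftrightarrow> \<sigma> \<subset> A \<union> B"
    and "B \<subseteq> \<sigma> \<Longrightarrow> \<sigma> \<notin> K"
    and "\<not> A \<subseteq> \<sigma> \<Longrightarrow> \<not> B \<subseteq> \<sigma> \<Longrightarrow> \<sigma> \<in> K \<longleftrightarrow> \<sigma> \<in> L"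
  using assms unfolding exchange_def by simp_all

text \<open>Pushes the simplex \<open>A\<close> across towards \<open>B\<close> until one of its barycentric coordinates vanishes.\<close>

definition shift :: "'v set \<Rightarrow> 'v set \<Rightarrow> ('v \<Rightarrow> real) \<Rightarrow> 'v \<Rightarrow> real" where
  "shift A B x v = x v - (if v \<in> A then Min (x ` A) else 0)
     + (if v \<in> B then Min (x ` A) * card A / card B else 0)"

lemma continuous_on_coordinate [continuous_intros]:
  "continuous_on S (\<lambda>x :: 'v \<Rightarrow> 'a::topological_space. x v)"
  by (rule continuous_on_subset[OF continuous_on_product_coordinates]) simp

lemma continuous_on_Min_coordinates:
  fixes S :: "('v \<Rightarrow> real) set"
  assumes "finite A" "A \<noteq> {}"
  shows "continuous_on S (\<lambda>x. Min (x ` A))"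
  using assms
proof (induction rule: finite_ne_induct)
  case (singleton a)
  show ?case by (simp add: continuous_on_coordinate)
next
  case (insert a A)
  have "continuous_on S (\<lambda>x. min (x a) (Min (x ` A)))"
    by (intro continuous_on_min continuous_on_coordinate insert.IH)
  then show ?case using insert by simp
qed

lemma continuous_on_shift:
  assumes "finite A" "A \<noteq> {}"
  shows "continuous_on S (shift A B)"
proof (rule continuous_on_coordinatewise_then_product)
  fix v
  have "shift A B x v = x v + (- of_bool (v \<in> A) + of_bool (v \<in> B) * (card A / card B)) * Min (x ` A)" for x
    by (simp add: shift_def algebra_simps)
  then show "continuous_on S (\<lambda>x. shift A B x v)"
    by (simp only:) (intro continuous_intros continuous_on_Min_coordinates assms)
qed

text \<open>Think of the barycenters of A and B as the same point. The shift takes equal mass from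
  all vertices of A and spreads it evenly over B, so it only rewrites the coordinates of a point.
  Since B is not a face of K, the minimum over B is 0 before the shift; afterwards it is exactly the
  mass received by each vertex of B, and this is what \<open>shift B A\<close> takes back.\<close>

lemma shift_exchange:
  assumes ex: "exchange A B K L" and K: "abstract_complex K" and L: "abstract_complex L"
    and x: "x \<in> underlying_space K"
  shows "shift A B x \<in> underlying_space L" "shift B A (shift A B x) = x"
proof -
  note x' = underlying_spaceD[OF K x]
  have fin: "finite A" "finite B" "A \<noteq> {}" "B \<noteq> {}" and AB: "A \<inter> B = {}"
    using exchangeD(1-5)[OF ex] .
  define S where "S = {v. x v \<noteq> 0}"
  define m where "m = Min (x ` A)"
  have m0: "0 \<le> m"
    unfolding m_def using fin x' by auto
  have mle: "m \<le> x v" if "v \<in> A" for v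
    unfolding m_def using fin that by auto
  have "m \<in> x ` A"
    unfolding m_def by (rule Min_in) (use fin in auto)
  then obtain a where a: "a \<in> A" "x a = m"
    by auto
  have nB: "\<not> B \<subseteq> S"
    using exchangeD(8)[OF ex] x'(2) unfolding S_def by metis
  then obtain b where b: "b \<in> B" "x b = 0"
    unfolding S_def by auto
  have minB: "Min (x ` B) = 0"
    by (rule Min_eqI) (use fin x' b in auto)
  have cards: "card A > 0" "card B > 0"
    using fin by (auto simp: card_gt_0_iff)
  have "shift A B x \<in> underlying_space L \<and> shift B A (shift A B x) = x"
  proof (cases "m = 0")
    \<comment> \<open>Here the point lies outside the open star of A, where K and L agree.\<close>
    case True
    then have sx: "shift A B x = x"
      by (auto simp: shift_def m_def fun_eq_iff)
    have "\<not> A \<subseteq> S"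
      using a True by (auto simp: S_def)
    then have "S \<in> L"
      using exchangeD(9)[OF ex _ nB] x'(2) unfolding S_def by simp
    then have "x \<in> underlying_space L"
      using underlying_space_iff[OF L, of S x] x' unfolding S_def by simp
    moreover have "shift B A x = x"
      by (auto simp: shift_def minB fun_eq_iff)
    ultimately show ?thesis using sx by simp
  next
    case False
    then have m: "m > 0" using m0 by simp
    have "A \<subseteq> S" using mle m by (force simp: S_def)
    then have S: "S \<subset> A \<union> B"
      using exchangeD(6)[OF ex] x'(2) unfolding S_def by simp
    define y where "y = shift A B x"
    have yv: "y v = x v - (if v \<in> A then m else 0) + (if v \<in> B then m * card A / card B else 0)" for v
      by (simp add: y_def shift_def m_def)
    have pos: "m * card A / card B > 0" using m cards by simp
    have ya: "y v = x v - m" if "v \<in> A" for v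
      using that AB yv[of v] by auto
    have yb: "y v = x v + m * card A / card B" if "v \<in> B" for v
      using that AB yv[of v] by auto
    have yo: "y v = 0" if "v \<notin> A \<union> B" for v
      using that S yv[of v] by (auto simp: S_def)
    have y0: "0 \<le> y v" for v
    proof (cases "v \<in> A \<union> B")
      case True
      then show ?thesis
        using ya[of v] yb[of v] mle[of v] x'(1)[of v] pos by auto
    qed (use yo[of v] in simp)
    have "B \<subseteq> {v. y v \<noteq> 0}"
    proof
      fix v assume "v \<in> B"
      then have "y v > 0" using yb[of v] x'(1)[of v] pos by linarith
      then show "v \<in> {v. y v \<noteq> 0}" by simp
    qed
    moreover have "{v. y v \<noteq> 0} \<subset> A \<union> B"
      using yo ya[OF a(1)] a by auto
    ultimately have yL: "{v. y v \<noteq> 0} \<in> L"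
      using exchangeD(7)[OF ex] by simp
    have "sum y (A \<union> B) = (\<Sum>v\<in>A. x v - m) + (\<Sum>v\<in>B. x v + m * card A / card B)"
      using fin AB by (simp add: sum.union_disjoint ya yb)
    also have "\<dots> = sum x (A \<union> B)"
      using fin AB cards by (simp add: sum.union_disjoint sum.distrib sum_subtractf)
    also have "\<dots> = 1"
      using underlying_space_iff[OF K, of "A \<union> B" x] fin S x by (auto simp: S_def)
    finally have y: "y \<in> underlying_space L"
      using underlying_space_iff[OF L, of "A \<union> B" y] y0 yL \<open>{v. y v \<noteq> 0} \<subset> A \<union> B\<close> fin by auto
    have "Min (y ` B) = m * card A / card B"
      by (rule Min_eqI) (use fin x' b yb in \<open>auto intro!: image_eqI[of _ _ b]\<close>)
    then have "shift B A y = x"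
      using cards AB by (auto simp: shift_def yv fun_eq_iff)
    with y show ?thesis by (simp add: y_def)
  qed
  then show "shift A B x \<in> underlying_space L" "shift B A (shift A B x) = x" by auto
qed

lemma exchange_commute: "exchange A B K L \<Longrightarrow> exchange B A L K"
  unfolding exchange_def by (auto simp: Un_commute Int_commute)

lemma exchange_homeomorphic:
  assumes "exchange A B K L" "abstract_complex K" "abstract_complex L"
  shows "top_of_set (underlying_space K) homeomorphic_space top_of_set (underlying_space L)"
  using shift_exchange[OF assms] shift_exchange[OF exchange_commute[OF assms(1)] assms(3,2)] assms(1)
  by (intro homeomorphic_spaceI_top_of_set[where f = "shift A B" and g = "shift B A"] continuous_on_shift)
     (auto simp: exchange_def)

text \<open>Assumption \<open>A\<close> says that the link of A is the boundary of B. A face of the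
  old star that contains neither A nor B misses some a and some b, so it lies both in the old facet
  without b and in the new facet without a; this is how it survives the exchange.\<close>

lemma exchange_complex_of:
  assumes AB: "finite A" "finite B" "A \<noteq> {}" "B \<noteq> {}" "A \<inter> B = {}"
    and A: "{t \<in> F. A \<subseteq> t} = (\<lambda>b. A \<union> B - {b}) ` B"
    and B: "\<And>t. t \<in> F \<Longrightarrow> \<not> B \<subseteq> t"
  shows "exchange A B (complex_of F)
    (complex_of ({t \<in> F. \<not> A \<subseteq> t} \<union> (\<lambda>a. A \<union> B - {a}) ` A))" (is "exchange A B ?K ?L")
proof -
  have facetK: "A \<union> B - {b} \<in> F" if "b \<in> B" for b
    using A that by blast
  have facetL: "A \<union> B - {a} \<in> {t \<in> F. \<not> A \<subseteq> t} \<union> (\<lambda>a. A \<union> B - {a}) ` A" if "a \<in> A" for a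
    using that by simp
  have K: "\<sigma> \<in> ?K \<longleftrightarrow> \<sigma> \<subset> A \<union> B" if s: "A \<subseteq> \<sigma>" for \<sigma>
  proof
    assume "\<sigma> \<in> ?K"
    then obtain t where t: "t \<in> F" "\<sigma> \<subseteq> t" by (rule complex_ofE)
    then obtain b where "b \<in> B" "t = A \<union> B - {b}" using s A by blast
    then show "\<sigma> \<subset> A \<union> B" using t by blast
  next
    assume "\<sigma> \<subset> A \<union> B"
    with s obtain b where b: "b \<in> B" "b \<notin> \<sigma>" "\<sigma> \<subseteq> A \<union> B" by auto
    show "\<sigma> \<in> ?K"
      by (rule complex_ofI[OF _ facetK[OF b(1)]]) (use b s AB in auto)
  qed
  have L: "\<sigma> \<in> ?L \<longleftrightarrow> \<sigma> \<subset> A \<union> B" if s: "B \<subseteq> \<sigma>" for \<sigma>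
  proof
    assume "\<sigma> \<in> ?L"
    then obtain t where t: "t \<in> {t \<in> F. \<not> A \<subseteq> t} \<union> (\<lambda>a. A \<union> B - {a}) ` A" "\<sigma> \<subseteq> t"
      by (rule complex_ofE)
    then have "t \<notin> F" using B s by blast
    then obtain a where "a \<in> A" "t = A \<union> B - {a}" using t by blast
    then show "\<sigma> \<subset> A \<union> B" using t by blast
  next
    assume "\<sigma> \<subset> A \<union> B"
    with s obtain a where a: "a \<in> A" "a \<notin> \<sigma>" "\<sigma> \<subseteq> A \<union> B" by auto
    show "\<sigma> \<in> ?L"
      by (rule complex_ofI[OF _ facetL[OF a(1)]]) (use a s AB in auto)
  qed
  have nL: "\<sigma> \<notin> ?L" if s: "A \<subseteq> \<sigma>" for \<sigma>
  proof
    assume "\<sigma> \<in> ?L"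
    then obtain t where "t \<in> {t \<in> F. \<not> A \<subseteq> t} \<union> (\<lambda>a. A \<union> B - {a}) ` A" "\<sigma> \<subseteq> t"
      by (rule complex_ofE)
    then show False using s by blast
  qed
  have nK: "\<sigma> \<notin> ?K" if "B \<subseteq> \<sigma>" for \<sigma>
    using that B by (meson complex_ofE order_trans)
  have KL: "\<sigma> \<in> ?K \<longleftrightarrow> \<sigma> \<in> ?L" if nA: "\<not> A \<subseteq> \<sigma>" and nB: "\<not> B \<subseteq> \<sigma>" for \<sigma>
  proof
    assume "\<sigma> \<in> ?K"
    then obtain t where t: "t \<in> F" "\<sigma> \<subseteq> t" "\<sigma> \<noteq> {}" by (rule complex_ofE)
    show "\<sigma> \<in> ?L"
    proof (cases "A \<subseteq> t")
      case True
      then obtain b where b: "b \<in> B" "t = A \<union> B - {b}" using t A by blast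
      obtain a where a: "a \<in> A" "a \<notin> \<sigma>" using nA by blast
      show ?thesis
        by (rule complex_ofI[OF t(3) facetL[OF a(1)]]) (use a b t in auto)
    next
      case False
      then show ?thesis
        by (intro complex_ofI[OF t(3) _ t(2)]) (use t in simp)
    qed
  next
    assume "\<sigma> \<in> ?L"
    then obtain t where t: "t \<in> {t \<in> F. \<not> A \<subseteq> t} \<union> (\<lambda>a. A \<union> B - {a}) ` A" "\<sigma> \<subseteq> t" "\<sigma> \<noteq> {}"
      by (rule complex_ofE)
    show "\<sigma> \<in> ?K"
    proof (cases "t \<in> F")
      case True
      then show ?thesis
        by (intro complex_ofI[OF t(3) _ t(2)])
    next
      case False
      then obtain a where a: "a \<in> A" "t = A \<union> B - {a}" using t by blast
      obtain b where b: "b \<in> B" "b \<notin> \<sigma>" using nB by blast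
      show ?thesis
        by (rule complex_ofI[OF t(3) facetK[OF b(1)]]) (use a b t in auto)
    qed
  qed
  show ?thesis
    unfolding exchange_def by (intro conjI allI impI AB K L nK nL KL)
qed

section \<open>Relabelling vertices\<close>

lemma relabel_homeomorphic:
  fixes f :: "'v \<Rightarrow> 'w"
  assumes F: "finite F" "\<And>t. t \<in> F \<Longrightarrow> finite t" and inj: "inj_on f (\<Union>F)"
  shows "top_of_set (underlying_space (complex_of F)) homeomorphic_space
    top_of_set (underlying_space (complex_of ((`) f ` F)))"
proof -
  define V where "V = \<Union>F"
  define g where "g = inv_into V f"
  have gf: "g (f v) = v" if "v \<in> V" for v
    using inj that by (simp add: g_def V_def)
  have finV: "finite V" using F by (auto simp: V_def)
  have K: "abstract_complex (complex_of F)" and L: "abstract_complex (complex_of ((`) f ` F))"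
    using F by (auto intro!: abstract_complex_of)
  define push :: "('v \<Rightarrow> real) \<Rightarrow> 'w \<Rightarrow> real" where "push x w = (if w \<in> f ` V then x (g w) else 0)" for x w
  define pull :: "('w \<Rightarrow> real) \<Rightarrow> 'v \<Rightarrow> real" where "pull y v = (if v \<in> V then y (f v) else 0)" for y v
  have sV: "{v. x v \<noteq> 0} \<subseteq> V" if "x \<in> underlying_space (complex_of F)" for x
    using underlying_spaceD(2)[OF K that] by (auto simp: complex_of_def V_def)
  have sfV: "{v. y v \<noteq> 0} \<subseteq> f ` V" if "y \<in> underlying_space (complex_of ((`) f ` F))" for y
    using underlying_spaceD(2)[OF L that] unfolding complex_of_def V_def by blast
  have injV: "inj_on f V" using inj by (simp add: V_def)
  show ?thesis
  proof (rule homeomorphic_spaceI_top_of_set[where f = push and g = pull])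
    show "continuous_on (underlying_space (complex_of F)) push"
    proof (rule continuous_on_coordinatewise_then_product)
      fix w show "continuous_on (underlying_space (complex_of F)) (\<lambda>x. push x w)"
        by (cases "w \<in> f ` V") (simp_all add: push_def continuous_on_coordinate)
    qed
    show "continuous_on (underlying_space (complex_of ((`) f ` F))) pull"
    proof (rule continuous_on_coordinatewise_then_product)
      fix v show "continuous_on (underlying_space (complex_of ((`) f ` F))) (\<lambda>y. pull y v)"
        by (cases "v \<in> V") (simp_all add: pull_def continuous_on_coordinate)
    qed
  next
    fix x assume x: "x \<in> underlying_space (complex_of F)"
    note x' = underlying_spaceD[OF K x]
    have "x v = 0" if "v \<notin> V" for v
      using sV[OF x] that by auto
    then have supp: "{w. push x w \<noteq> 0} = f ` {v. x v \<noteq> 0}"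
      by (auto simp: push_def gf image_iff) (metis gf)+
    obtain t where t: "t \<in> F" "{v. x v \<noteq> 0} \<subseteq> t" "{v. x v \<noteq> 0} \<noteq> {}"
      using x'(2) by (auto simp: complex_of_def)
    have "{w. push x w \<noteq> 0} \<in> complex_of ((`) f ` F)"
      unfolding supp complex_of_def using t by blast
    moreover have "sum (push x) (f ` V) = 1"
    proof -
      have "sum (push x) (f ` V) = sum x V"
        using injV by (subst sum.reindex) (auto simp: push_def gf)
      also have "\<dots> = 1"
        using underlying_space_iff[OF K finV sV[OF x]] x by auto
      finally show ?thesis .
    qed
    ultimately have "push x \<in> underlying_space (complex_of ((`) f ` F))"
      using underlying_space_iff[OF L, of "f ` V" "push x"] finV x'(1) supp sV[OF x]
      by (simp add: image_mono) (simp add: push_def)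
    moreover have "pull (push x) = x"
      using sV[OF x] by (auto simp: push_def pull_def gf fun_eq_iff)
    ultimately show "push x \<in> underlying_space (complex_of ((`) f ` F)) \<and> pull (push x) = x" by simp
  next
    fix y assume y: "y \<in> underlying_space (complex_of ((`) f ` F))"
    note y' = underlying_spaceD[OF L y]
    have supp: "f ` {v. pull y v \<noteq> 0} = {w. y w \<noteq> 0}"
      using sfV[OF y] by (auto simp: pull_def)
    obtain t where t: "t \<in> F" "{w. y w \<noteq> 0} \<subseteq> f ` t" "{w. y w \<noteq> 0} \<noteq> {}"
      using y'(2) by (auto simp: complex_of_def)
    have pV: "{v. pull y v \<noteq> 0} \<subseteq> V"
      by (auto simp: pull_def)
    have "{v. pull y v \<noteq> 0} \<subseteq> t"
    proof
      fix v assume v: "v \<in> {v. pull y v \<noteq> 0}"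
      then have "f v \<in> f ` t" "v \<in> V" using supp t by (auto simp: pull_def split: if_splits)
      then show "v \<in> t" using injV t(1) by (auto simp: V_def inj_on_def)
    qed
    then have "{v. pull y v \<noteq> 0} \<in> complex_of F"
      using t supp unfolding complex_of_def by blast
    moreover have "sum (pull y) V = 1"
    proof -
      have "sum (pull y) V = sum y (f ` V)"
        using injV by (subst sum.reindex) (auto simp: pull_def)
      also have "\<dots> = 1"
        using underlying_space_iff[OF L _ sfV[OF y]] y finV by auto
      finally show ?thesis .
    qed
    ultimately have "pull y \<in> underlying_space (complex_of F)"
      using underlying_space_iff[OF K finV pV] y'(1)
      by simp (simp add: pull_def)
    moreover have "push (pull y) = y"
      using sfV[OF y] by (auto simp: push_def pull_def gf fun_eq_iff)
    ultimately show "pull y \<in> underlying_space (complex_of F) \<and> push (pull y) = y" by simp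
  qed
qed

section \<open>Connected sums along a triangle\<close>

definition closed_simplex :: "'v set \<Rightarrow> ('v \<Rightarrow> real) set" where
  "closed_simplex \<sigma> = {x. (\<forall>v. 0 \<le> x v) \<and> {v. x v \<noteq> 0} \<subseteq> \<sigma> \<and> sum x \<sigma> = 1}"

lemma underlying_space_eq:
  assumes "abstract_complex K"
  shows "underlying_space K = {x. (\<forall>v. 0 \<le> x v) \<and> {v. x v \<noteq> 0} \<in> K \<and> sum x {v. x v \<noteq> 0} = 1}"
    (is "?L = ?R")
proof (intro set_eqI iffI)
  fix x assume x: "x \<in> ?R"
  then have "finite {v. x v \<noteq> 0}"
    using abstract_complexD(3)[OF assms] by blast
  then show "x \<in> ?L"
    using underlying_space_iff[OF assms, of "{v. x v \<noteq> 0}" x] x by simp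
qed (use underlying_spaceD[OF assms] in simp)

lemma closed_simplex_supp:
  assumes "finite \<sigma>" "x \<in> closed_simplex \<sigma>"
  shows "sum x {v. x v \<noteq> 0} = 1" "{v. x v \<noteq> 0} \<noteq> {}"
proof -
  have "sum x \<sigma> = sum x {v. x v \<noteq> 0}"
    using assms by (intro sum.mono_neutral_right) (auto simp: closed_simplex_def)
  then show 1: "sum x {v. x v \<noteq> 0} = 1"
    using assms(2) by (simp add: closed_simplex_def)
  show "{v. x v \<noteq> 0} \<noteq> {}"
  proof
    assume "{v. x v \<noteq> 0} = {}"
    then show False using 1 by simp
  qed
qed

lemma underlying_space_Union:
  assumes K: "abstract_complex K"
  shows "underlying_space K = (\<Union>\<sigma>\<in>K. closed_simplex \<sigma>)"
proof (intro set_eqI iffI)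
  fix x assume "x \<in> underlying_space K"
  note x = underlying_spaceD[OF K this]
  have "x \<in> closed_simplex {v. x v \<noteq> 0}"
    using x(1,4) by (simp add: closed_simplex_def)
  then show "x \<in> (\<Union>\<sigma>\<in>K. closed_simplex \<sigma>)"
    using x(2) by (rule UN_I[rotated])
next
  fix x assume "x \<in> (\<Union>\<sigma>\<in>K. closed_simplex \<sigma>)"
  then obtain \<sigma> where \<sigma>: "\<sigma> \<in> K" "x \<in> closed_simplex \<sigma>" by blast
  note s = closed_simplex_supp[OF abstract_complexD(3)[OF K \<sigma>(1)] \<sigma>(2)]
  have "{v. x v \<noteq> 0} \<in> K"
    using \<sigma>(2) by (intro abstract_complexD(5)[OF K \<sigma>(1) s(2)]) (auto simp: closed_simplex_def)
  then show "x \<in> underlying_space K"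
    using s \<sigma>(2) by (simp add: underlying_space_eq[OF K] closed_simplex_def)
qed

lemma closed_closed_simplex: "closed (closed_simplex (\<sigma> :: 'v set))"
proof -
  have "closed {x :: 'v \<Rightarrow> real. 0 \<le> x v}" for v
    by (intro closed_Collect_le continuous_on_coordinate continuous_intros)
  moreover have "closed {x :: 'v \<Rightarrow> real. v \<in> \<sigma> \<or> x v = 0}" for v
    by (cases "v \<in> \<sigma>") (simp_all add: closed_Collect_eq continuous_on_coordinate)
  moreover have "closed {x :: 'v \<Rightarrow> real. sum x \<sigma> = 1}"
    by (intro closed_Collect_eq continuous_on_sum continuous_on_coordinate continuous_intros)
  moreover have "closed_simplex \<sigma> = (\<Inter>v. {x. 0 \<le> x v}) \<inter> (\<Inter>v. {x. v \<in> \<sigma> \<or> x v = 0}) \<inter> {x. sum x \<sigma> = 1}"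
    by (auto simp: closed_simplex_def)
  ultimately show ?thesis
    by (simp add: closed_INT closed_Int)
qed

lemma closed_underlying_space:
  assumes "abstract_complex K"
  shows "closed (underlying_space K)"
  unfolding underlying_space_Union[OF assms]
  using abstract_complexD(1)[OF assms] by (intro closed_UN) (auto intro: closed_closed_simplex)

text \<open>The triangle is modelled in the plane, where compact convex sets of equal dimension are
  homeomorphic. That the open disc goes onto the open triangle is invariance of domain, applied to
  the homeomorphism and to its inverse.\<close>

lemma triangle_disc:
  assumes abc: "a \<noteq> b" "a \<noteq> c" "b \<noteq> c" and t: "t = {a, b, c :: 'v}"
  obtains d :: "complex \<Rightarrow> 'v \<Rightarrow> real" where
    "continuous_on (cball 0 1) d" "inj_on d (cball 0 1)" "d ` cball 0 1 = closed_simplex t"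
    "d ` ball 0 1 = {x \<in> closed_simplex t. {v. x v \<noteq> 0} = t}"
proof -
  define T where "T = {z. 0 \<le> Re z \<and> 0 \<le> Im z \<and> Re z + Im z \<le> 1}"
  define e where "e z v = (if v = a then Re z else if v = b then Im z
    else if v = c then 1 - Re z - Im z else 0)" for z v
  have Tcl: "closed T"
    unfolding T_def by (intro closed_Collect_conj closed_Collect_le continuous_intros)
  have "bounded T"
  proof (rule boundedI)
    fix z assume "z \<in> T"
    then show "norm z \<le> 1"
      using cmod_le[of z] unfolding T_def by auto
  qed
  with Tcl have Tco: "compact T"
    by (simp add: compact_eq_bounded_closed)
  have Tconv: "convex T"
  proof -
    have "T = {z. inner (-1) z \<le> 0} \<inter> {z. inner (-\<i>) z \<le> 0} \<inter> {z. inner (1 + \<i>) z \<le> 1}"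
      by (auto simp: T_def inner_complex_def)
    then show ?thesis
      by (simp only:) (intro convex_Int convex_halfspace_le)
  qed
  define I where "I = {z. 0 < Re z \<and> 0 < Im z \<and> Re z + Im z < 1}"
  have Iop: "open I"
    unfolding I_def by (intro open_Collect_conj open_Collect_less continuous_intros)
  have IT: "I \<subseteq> interior T"
    using Iop by (intro interior_maximal) (auto simp: I_def T_def)
  have TI: "interior T \<subseteq> I"
  proof
    fix z assume "z \<in> interior T"
    then obtain r where r: "r > 0" "ball z r \<subseteq> T"
      by (auto simp: mem_interior)
    have shift: "z + w \<in> T" if "norm w < r" for w
      using r(2) that by (auto simp: dist_norm)
    \<comment> \<open>One test point beyond z for each of the three sides, which makes the three
      inequalities strict.\<close>
    have "z + of_real (-r/2) \<in> T" "z + of_real (-r/2) * \<i> \<in> T" "z + of_real (r/2) \<in> T"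
      using r by (auto intro!: shift simp: norm_mult)
    then show "z \<in> I"
      using r(1) by (auto simp: I_def T_def)
  qed
  have intT: "interior T = I" using IT TI by blast
  have "Complex (1/4) (1/4) \<in> I" by (simp add: I_def)
  then have "interior T \<noteq> {}" using intT by blast
  then have "aff_dim T = 2"
    by (simp add: aff_dim_nonempty_interior)
  moreover have "aff_dim (cball (0::complex) 1) = 2"
    by (simp add: aff_dim_cball)
  ultimately have "cball (0::complex) 1 homeomorphic T"
    using Tconv Tco by (intro homeomorphic_convex_compact_sets) auto
  then obtain h k where hk: "homeomorphism (cball (0::complex) 1) T h k"
    by (auto simp: homeomorphic_def)
  then have h: "continuous_on (cball 0 1) h" "inj_on h (cball 0 1)" "h ` cball 0 1 = T"
    and k: "continuous_on T k" "inj_on k T" "k ` T = cball 0 1"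
    and kh: "\<And>z. z \<in> cball 0 1 \<Longrightarrow> k (h z) = z"
    and hk': "\<And>z. z \<in> T \<Longrightarrow> h (k z) = z"
    unfolding homeomorphism_def by (auto simp: inj_on_def) (metis mem_cball_0)+
  have hI: "h ` ball 0 1 = I"
  proof
    show "h ` ball 0 1 \<subseteq> I"
      using continuous_image_subset_interior[OF h(1,2)] by (auto simp: h(3) intT)
    have "k ` I \<subseteq> ball 0 1"
      using continuous_image_subset_interior[OF k(1,2)] by (auto simp: k(3) intT)
    moreover have "I \<subseteq> T" using interior_subset intT by blast
    ultimately show "I \<subseteq> h ` ball 0 1"
      using hk' by (metis image_eqI subsetD subsetI)
  qed
  have ce: "continuous_on S e" for S
  proof (rule continuous_on_coordinatewise_then_product)
    fix v show "continuous_on S (\<lambda>z. e z v)"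
      unfolding e_def by (cases "v = a"; cases "v = b"; cases "v = c") (auto intro!: continuous_intros)
  qed
  have ie: "inj e"
  proof (rule injI)
    fix z w assume "e z = e w"
    then have "e z a = e w a" "e z b = e w b" by auto
    then show "z = w" using abc by (simp add: e_def complex_eq_iff)
  qed
  have eT: "x \<in> e ` T" if "x \<in> closed_simplex t" for x
  proof
    have x: "x a + x b + x c = 1" "0 \<le> x a" "0 \<le> x b" "0 \<le> x c"
      "\<And>v. v \<noteq> a \<Longrightarrow> v \<noteq> b \<Longrightarrow> v \<noteq> c \<Longrightarrow> x v = 0"
      using that abc by (auto simp: closed_simplex_def t)
    then show "Complex (x a) (x b) \<in> T" by (simp add: T_def)
    show "x = e (Complex (x a) (x b))"
      using x abc by (auto simp: e_def fun_eq_iff)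
  qed
  have eT': "e z \<in> closed_simplex t" if "z \<in> T" for z
    using that abc by (auto simp: closed_simplex_def t e_def T_def)
  have eI: "{v. e z v \<noteq> 0} = t \<longleftrightarrow> z \<in> I" if "z \<in> T" for z
  proof -
    have "{v. e z v \<noteq> 0} = t \<longleftrightarrow> e z a \<noteq> 0 \<and> e z b \<noteq> 0 \<and> e z c \<noteq> 0"
      by (auto simp: t e_def)
    also have "\<dots> \<longleftrightarrow> z \<in> I"
      using that abc by (auto simp: e_def T_def I_def)
    finally show ?thesis .
  qed
  have IT': "I \<subseteq> T" by (auto simp: I_def T_def)
  show thesis
  proof (rule that[of "e \<circ> h"])
    show "continuous_on (cball 0 1) (e \<circ> h)"
      using h(1) ce by (rule continuous_on_compose)
    show "inj_on (e \<circ> h) (cball 0 1)"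
      using h(2) ie by (auto simp: inj_on_def)
    have "e ` T = closed_simplex t"
      using eT eT' by blast
    then show "(e \<circ> h) ` cball 0 1 = closed_simplex t"
      by (simp only: image_comp[symmetric] h(3))
    have "e ` I = {x \<in> closed_simplex t. {v. x v \<noteq> 0} = t}"
    proof (intro set_eqI iffI)
      fix x assume "x \<in> {x \<in> closed_simplex t. {v. x v \<noteq> 0} = t}"
      moreover then obtain z where "z \<in> T" "x = e z" using eT by blast
      ultimately show "x \<in> e ` I" using eI by auto
    qed (use eT' eI IT' in auto)
    then show "(e \<circ> h) ` ball 0 1 = {x \<in> closed_simplex t. {v. x v \<noteq> 0} = t}"
      by (simp only: image_comp[symmetric] hI)
  qed
qed

text \<open>Both discs are the same map onto the closed triangle t, because F and G share t and
  coordinates are functions on the common vertex type. Points on the two boundary circles are then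
  identified exactly when they are equal as functions, and gluing means forgetting the summand.
  Assumption \<open>edges\<close> keeps the boundary of t: an edge of a deleted facet remains in a
  complex given by facets only if another facet contains it.\<close>

lemma connected_sum_complex_of:
  fixes F G :: "nat set set"
  assumes fin: "finite F" "finite G"
    and card: "\<And>s. s \<in> F \<union> G \<Longrightarrow> card s = 3"
    and t: "t \<in> F" "t \<in> G" and int: "\<Union>F \<inter> \<Union>G = t"
    and edges: "\<And>v. v \<in> t \<Longrightarrow> \<exists>s\<in>F - {t}. t - {v} \<subseteq> s"
  shows "connected_sum (top_of_set (underlying_space (complex_of F)))
    (top_of_set (underlying_space (complex_of G)))
    (top_of_set (underlying_space (complex_of ((F - {t}) \<union> (G - {t})))))"
proof -
  define H where "H = (F - {t}) \<union> (G - {t})"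
  have fins: "finite s" if "s \<in> F \<union> G" for s
    using card[OF that] by (metis card.infinite zero_neq_numeral)
  have KF: "abstract_complex (complex_of F)" and KG: "abstract_complex (complex_of G)"
    and KH: "abstract_complex (complex_of H)"
    using fin fins by (auto intro!: abstract_complex_of simp: H_def)
  have tmax: "s = t" if "s \<in> F \<union> G" "t \<subseteq> s" for s
    using card_subset_eq[OF fins[OF that(1)] that(2)] card[OF that(1)] card t by auto
  have drop: "abstract_complex (complex_of E - {t})"
    if "abstract_complex (complex_of E)" "E \<subseteq> F \<union> G" for E
  proof -
    have "\<tau> \<in> complex_of E - {t}" if st: "\<sigma> \<in> complex_of E - {t}" "\<tau> \<noteq> {}" "\<tau> \<subseteq> \<sigma>" for \<sigma> \<tau>
    proof -
      have "\<tau> \<in> complex_of E"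
        using abstract_complexD(5)[OF \<open>abstract_complex (complex_of E)\<close>] st by blast
      moreover have "\<tau> \<noteq> t"
      proof
        assume "\<tau> = t"
        obtain s where "s \<in> E" "\<sigma> \<subseteq> s" using st(1) by (auto simp: complex_of_def)
        then have "s = t" using tmax \<open>E \<subseteq> F \<union> G\<close> \<open>\<tau> = t\<close> st(3) by blast
        then show False using \<open>\<sigma> \<subseteq> s\<close> st \<open>\<tau> = t\<close> by blast
      qed
      ultimately show ?thesis by simp
    qed
    moreover have "finite (complex_of E - {t})"
      using abstract_complexD(1)[OF that(1)] by simp
    moreover have "finite \<sigma> \<and> \<sigma> \<noteq> {}" if "\<sigma> \<in> complex_of E - {t}" for \<sigma>
      using abstract_complexD(3,4)[OF \<open>abstract_complex (complex_of E)\<close>] that by blast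
    ultimately show ?thesis
      unfolding abstract_complex_def by blast
  qed
  have DF: "abstract_complex (complex_of F - {t})" and DG: "abstract_complex (complex_of G - {t})"
    using drop KF KG by auto
  have t0: "t \<noteq> {}" using card[of t] t by auto
  have HFG: "complex_of H = (complex_of F - {t}) \<union> (complex_of G - {t})"
  proof (intro set_eqI iffI)
    fix \<sigma> assume "\<sigma> \<in> complex_of H"
    then obtain s where s: "s \<in> H" "\<sigma> \<subseteq> s" "\<sigma> \<noteq> {}" by (rule complex_ofE)
    then have "\<sigma> \<noteq> t" using tmax by (auto simp: H_def)
    then show "\<sigma> \<in> (complex_of F - {t}) \<union> (complex_of G - {t})"
      using s by (auto simp: H_def complex_of_def)
  next
    fix \<sigma> assume \<sigma>: "\<sigma> \<in> (complex_of F - {t}) \<union> (complex_of G - {t})"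
    then obtain s where s: "s \<in> F \<union> G" "\<sigma> \<subseteq> s" "\<sigma> \<noteq> {}" "\<sigma> \<noteq> t" by (auto simp: complex_of_def)
    show "\<sigma> \<in> complex_of H"
    proof (cases "s = t")
      case True
      then obtain v where v: "v \<in> t" "\<sigma> \<subseteq> t - {v}" using s by blast
      then obtain s' where "s' \<in> F - {t}" "t - {v} \<subseteq> s'" using edges by blast
      then show ?thesis using v s(3) by (intro complex_ofI[of _ s']) (auto simp: H_def)
    next
      case False
      then show ?thesis using s by (intro complex_ofI[of _ s]) (auto simp: H_def)
    qed
  qed
  have FG: "complex_of F \<inter> complex_of G \<subseteq> {\<sigma>. \<sigma> \<subseteq> t}"
    using int by (auto simp: complex_of_def)
  define T0 where "T0 = {x \<in> closed_simplex t. {v. x v \<noteq> 0} = t}"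
  have ft: "finite t" using fins t by blast
  have tF: "t \<in> complex_of F" "t \<in> complex_of G"
    using t t0 by (auto intro: complex_ofI)
  have sub: "underlying_space K - T0 = underlying_space (K - {t})"
    if "abstract_complex K" "abstract_complex (K - {t})" for K
    using that by (auto simp: underlying_space_eq T0_def closed_simplex_def)
  have ZFG: "underlying_space (complex_of H) =
      (underlying_space (complex_of F) - T0) \<union> (underlying_space (complex_of G) - T0)"
    unfolding sub[OF KF DF] sub[OF KG DG]
    unfolding HFG underlying_space_eq[OF KH[unfolded HFG]] underlying_space_eq[OF DF] underlying_space_eq[OF DG]
    by blast
  \<comment> \<open>As t is a maximal face, positivity on t already forces the support to be t. This
    describes the open triangle by strict inequalities and makes it open in both spaces.\<close>
  have T0K: "T0 = underlying_space (complex_of F) \<inter> {x. \<forall>v\<in>t. 0 < x v}"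
    "T0 = underlying_space (complex_of G) \<inter> {x. \<forall>v\<in>t. 0 < x v}"
  proof -
    have "x \<in> T0 \<longleftrightarrow> x \<in> underlying_space (complex_of E) \<inter> {x. \<forall>v\<in>t. 0 < x v}"
      if E: "abstract_complex (complex_of E)" "E \<subseteq> F \<union> G" "t \<in> complex_of E" for x E
    proof
      assume "x \<in> T0"
      moreover then have "x \<in> underlying_space (complex_of E)"
        using underlying_space_Union[OF E(1)] E(3) by (auto simp: T0_def)
      ultimately show "x \<in> underlying_space (complex_of E) \<inter> {x. \<forall>v\<in>t. 0 < x v}"
        by (auto simp: T0_def closed_simplex_def order_less_le)
    next
      assume x: "x \<in> underlying_space (complex_of E) \<inter> {x. \<forall>v\<in>t. 0 < x v}"
      then have "{v. x v \<noteq> 0} \<in> complex_of E"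
        using underlying_spaceD(2)[OF E(1)] by simp
      then obtain s where s: "s \<in> E" "{v. x v \<noteq> 0} \<subseteq> s"
        by (rule complex_ofE)
      have ts: "t \<subseteq> {v. x v \<noteq> 0}" using x by fastforce
      then have "{v. x v \<noteq> 0} = t" using tmax[of s] s E(2) by blast
      then show "x \<in> T0"
        using underlying_spaceD[OF E(1), of x] x by (auto simp: T0_def closed_simplex_def)
    qed
    then show "T0 = underlying_space (complex_of F) \<inter> {x. \<forall>v\<in>t. 0 < x v}"
      "T0 = underlying_space (complex_of G) \<inter> {x. \<forall>v\<in>t. 0 < x v}"
      using KF KG tF by blast+
  qed
  have posopen: "open {x :: nat \<Rightarrow> real. \<forall>v\<in>t. 0 < x v}"
  proof -
    have "{x :: nat \<Rightarrow> real. \<forall>v\<in>t. 0 < x v} = (\<Inter>v\<in>t. {x. 0 < x v})" by auto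
    moreover have "open {x :: nat \<Rightarrow> real. 0 < x v}" for v
      by (intro open_Collect_less continuous_on_coordinate continuous_intros)
    ultimately show ?thesis using ft by (simp add: open_INT)
  qed
  obtain a b c where abc: "t = {a, b, c}" "a \<noteq> b" "a \<noteq> c" "b \<noteq> c"
    using card[of t] t by (auto simp: card_3_iff)
  obtain d :: "complex \<Rightarrow> nat \<Rightarrow> real" where
    d: "continuous_on (cball 0 1) d" "inj_on d (cball 0 1)" "d ` cball 0 1 = closed_simplex t"
    and dT0: "d ` ball 0 1 = T0"
    unfolding T0_def by (rule triangle_disc[OF abc(2-4,1)])
  have emb: "embedding_map (top_of_set (cball 0 1)) (top_of_set (underlying_space K)) d"
    if K: "abstract_complex K" "t \<in> K" for K
  proof (rule injective_closed_imp_embedding_map)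
    have sK: "closed_simplex t \<subseteq> underlying_space K"
      using underlying_space_Union[OF K(1)] K(2) by blast
    then show "continuous_map (top_of_set (cball 0 1)) (top_of_set (underlying_space K)) d"
      using d by auto
    show "closed_map (top_of_set (cball 0 1)) (top_of_set (underlying_space K)) d"
      unfolding closed_map_def
    proof (intro allI impI)
      fix U :: "complex set" assume "closedin (top_of_set (cball 0 1)) U"
      then have U: "compact U" "U \<subseteq> cball 0 1"
        by (simp_all add: closedin_compact_eq)
      then have "compact (d ` U)"
        by (intro compact_continuous_image continuous_on_subset[OF d(1)])
      moreover have "d ` U \<subseteq> underlying_space K"
        using sK image_mono[OF U(2), of d] by (simp only: d(3))
      ultimately show "closedin (top_of_set (underlying_space K)) (d ` U)"
        by (intro closed_subset compact_imp_closed)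
    qed
    show "inj_on d (topspace (top_of_set (cball 0 1)))"
      using d by simp
  qed
  define W where "W = sum_topology (\<lambda>b. if b
      then subtopology (top_of_set (underlying_space (complex_of G))) (topspace (top_of_set (underlying_space (complex_of G))) - d ` ball 0 1)
      else subtopology (top_of_set (underlying_space (complex_of F))) (topspace (top_of_set (underlying_space (complex_of F))) - d ` ball 0 1)) UNIV"
  have W: "W = sum_topology (\<lambda>b. if b then top_of_set (underlying_space (complex_of G - {t}))
      else top_of_set (underlying_space (complex_of F - {t}))) UNIV"
  proof -
    have "subtopology (top_of_set A) (topspace (top_of_set A) - T0) = top_of_set (A - T0)" for A
      by (simp add: subtopology_subtopology Int_absorb1)
    then show ?thesis
      unfolding W_def dT0 by (simp only: sub[OF KF DF] sub[OF KG DG])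
  qed
  have topW: "(b, x) \<in> topspace W \<longleftrightarrow> x \<in> underlying_space ((if b then complex_of G else complex_of F) - {t})" for b x
    by (simp add: W)
  have snd_img: "snd ` topspace W = underlying_space (complex_of H)"
  proof (intro set_eqI iffI)
    fix x assume "x \<in> underlying_space (complex_of H)"
    then have "(True, x) \<in> topspace W \<or> (False, x) \<in> topspace W"
      unfolding ZFG sub[OF KF DF] sub[OF KG DG] topW by auto
    then show "x \<in> snd ` topspace W" by force
  next
    fix x assume "x \<in> snd ` topspace W"
    then obtain b where "(b, x) \<in> topspace W" by auto
    then show "x \<in> underlying_space (complex_of H)"
      unfolding ZFG sub[OF KF DF] sub[OF KG DG] topW by (cases b) auto
  qed
  have "quotient_map W (top_of_set (underlying_space (complex_of H))) snd"
  proof (rule continuous_closed_imp_quotient_map)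
    show "snd ` topspace W = topspace (top_of_set (underlying_space (complex_of H)))"
      using snd_img by simp
    have "continuous_map W euclidean snd"
      unfolding W continuous_map_def
      by (auto simp: openin_sum_topology openin_open Int_def)
    then show "continuous_map W (top_of_set (underlying_space (complex_of H))) snd"
      using snd_img by (auto simp: continuous_map_in_subtopology)
    show "closed_map W (top_of_set (underlying_space (complex_of H))) snd"
      unfolding closed_map_def
    proof (intro allI impI)
      fix U assume U: "closedin W U"
      then have UW: "U \<subseteq> topspace W" by (rule closedin_subset)
      have "closedin (top_of_set (underlying_space (complex_of G - {t}))) {x. (True, x) \<in> U}"
        "closedin (top_of_set (underlying_space (complex_of F - {t}))) {x. (False, x) \<in> U}"
        using U unfolding W closedin_sum_topology by (auto split: if_splits elim: allE[of _ True] allE[of _ False])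
      \<comment> \<open>Each piece is closed in the space of all functions, so its relatively closed
        subsets are closed there; the image in question is a union of two of them.\<close>
      then have "closed {x. (True, x) \<in> U}" "closed {x. (False, x) \<in> U}"
        using closedin_closed_trans closed_underlying_space[OF DF] closed_underlying_space[OF DG] by blast+
      moreover have "snd ` U = {x. (True, x) \<in> U} \<union> {x. (False, x) \<in> U}"
      proof (intro set_eqI iffI)
        fix x assume "x \<in> snd ` U"
        then obtain b where "(b, x) \<in> U" by auto
        then show "x \<in> {x. (True, x) \<in> U} \<union> {x. (False, x) \<in> U}"
          by (cases b) auto
      qed (auto intro: rev_image_eqI)
      ultimately have "closed (snd ` U)" by (simp add: closed_Un)
      moreover have "snd ` U \<subseteq> underlying_space (complex_of H)"
        using UW snd_img by blast
      ultimately show "closedin (top_of_set (underlying_space (complex_of H))) (snd ` U)"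
        by (intro closed_subset)
    qed
  qed
  moreover have "snd s = snd r \<longleftrightarrow> s = r \<or> (\<exists>z\<in>sphere 0 1. {s, r} = {(False, d z), (True, d z)})"
    if s: "s \<in> topspace W" and r: "r \<in> topspace W" for s r
  proof
    assume eq: "snd s = snd r"
    \<comment> \<open>A point of both pieces has its support in both complexes, hence inside t, but
      different from t: it lies on the boundary of the triangle.\<close>
    have *: "\<exists>z\<in>sphere 0 1. x = d z" if "(True, x) \<in> topspace W" "(False, x) \<in> topspace W" for x
    proof -
      have x: "x \<in> underlying_space (complex_of G - {t})" "x \<in> underlying_space (complex_of F - {t})"
        using that by (simp_all add: topW)
      note xF = underlying_spaceD[OF DF x(2)] and xG = underlying_spaceD[OF DG x(1)]
      have st: "{v. x v \<noteq> 0} \<subseteq> t" "{v. x v \<noteq> 0} \<noteq> t"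
        using xF(2) xG(2) FG by blast+
      have "sum x t = sum x {v. x v \<noteq> 0}"
        using ft st(1) by (intro sum.mono_neutral_right) auto
      then have "x \<in> closed_simplex t - T0"
        using xF st by (auto simp: closed_simplex_def T0_def)
      then obtain z where "z \<in> cball 0 1" "x = d z" "z \<notin> ball 0 1"
        unfolding d(3)[symmetric] dT0[symmetric] by blast
      then show ?thesis by auto
    qed
    show "s = r \<or> (\<exists>z\<in>sphere 0 1. {s, r} = {(False, d z), (True, d z)})"
    proof (cases "s = r")
      case False
      obtain b x where sb: "s = (b, x)" by (cases s)
      then have "r = (\<not> b, x)" using eq False by (cases r) auto
      moreover have "(True, x) \<in> topspace W" "(False, x) \<in> topspace W"
        using s r sb \<open>r = (\<not> b, x)\<close> by (cases b; simp)+
      then obtain z where "z \<in> sphere 0 1" "x = d z" using * by blast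
      ultimately show ?thesis using sb by (cases b) auto
    qed simp
  next
    assume "s = r \<or> (\<exists>z\<in>sphere 0 1. {s, r} = {(False, d z), (True, d z)})"
    then show "snd s = snd r" by (auto simp: doubleton_eq_iff)
  qed
  moreover have "openin (top_of_set (underlying_space (complex_of F))) (d ` ball 0 1)"
    "openin (top_of_set (underlying_space (complex_of G))) (d ` ball 0 1)"
    unfolding dT0 using T0K posopen by (metis openin_open)+
  ultimately show ?thesis
    unfolding connected_sum_def H_def[symmetric]
    using emb[OF KF tF(1)] emb[OF KG tF(2)]
    by (intro exI[of _ d] exI[of _ snd]) (simp add: Let_def W_def[symmetric])
qed

section \<open>Invariance of the surfaces under homeomorphism\<close>

lemma projective_plane_homeomorphic:
  assumes "projective_plane P" "P homeomorphic_space Q"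
  shows "projective_plane Q"
proof -
  obtain q where q: "quotient_map (top_of_set (sphere (0::real^3) 1)) P q"
    "\<And>x y. x \<in> sphere 0 1 \<Longrightarrow> y \<in> sphere 0 1 \<Longrightarrow> q x = q y \<longleftrightarrow> x = y \<or> x = - y"
    using assms(1) by (auto simp: projective_plane_def)
  obtain f where f: "homeomorphic_map P Q f"
    using assms(2) by (auto simp: homeomorphic_space)
  have inj: "inj_on f (topspace P)" and im: "q ` sphere 0 1 = topspace P"
    using f quotient_imp_surjective_map[OF q(1)] by (auto simp: homeomorphic_map_def)
  have "quotient_map (top_of_set (sphere (0::real^3) 1)) Q (f \<circ> q)"
    using q(1) f by (auto simp: homeomorphic_map_def intro: quotient_map_compose)
  moreover have "(f \<circ> q) x = (f \<circ> q) y \<longleftrightarrow> x = y \<or> x = - y"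
    if "x \<in> sphere 0 1" "y \<in> sphere 0 1" for x y
  proof -
    have "q x \<in> topspace P" "q y \<in> topspace P" using im that by blast+
    then show ?thesis using inj_on_eq_iff[OF inj] q(2)[OF that] by simp
  qed
  ultimately show ?thesis
    unfolding projective_plane_def by blast
qed

lemma connected_sum_homeomorphic:
  assumes "connected_sum X Y Z" "Z homeomorphic_space Z'"
  shows "connected_sum X Y Z'"
proof -
  obtain f where f: "homeomorphic_map Z Z' f"
    using assms(2) by (auto simp: homeomorphic_space)
  then have inj: "inj_on f (topspace Z)" and fq: "quotient_map Z Z' f"
    by (auto simp: homeomorphic_map_def)
  have *: "quotient_map W Z' (f \<circ> q) \<and> (\<forall>s\<in>topspace W. \<forall>t\<in>topspace W. (f \<circ> q) s = (f \<circ> q) t \<longleftrightarrow> R s t)"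
    if q: "quotient_map W Z q" "\<forall>s\<in>topspace W. \<forall>t\<in>topspace W. q s = q t \<longleftrightarrow> R s t" for W q R
  proof -
    have im: "q ` topspace W = topspace Z" using q(1) by (rule quotient_imp_surjective_map)
    have "(f \<circ> q) s = (f \<circ> q) t \<longleftrightarrow> R s t" if "s \<in> topspace W" "t \<in> topspace W" for s t
      using inj_on_eq_iff[OF inj, of "q s" "q t"] im q(2) that by auto
    then show ?thesis using quotient_map_compose[OF q(1) fq] by blast
  qed
  obtain d e q where
    "embedding_map (top_of_set (cball (0::complex) 1)) X d" "openin X (d ` ball 0 1)"
    "embedding_map (top_of_set (cball (0::complex) 1)) Y e" "openin Y (e ` ball 0 1)"
    "let W = sum_topology
                   (\<lambda>b. if b then subtopology Y (topspace Y - e ` ball 0 1)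
                        else subtopology X (topspace X - d ` ball 0 1)) UNIV
         in quotient_map W Z q \<and>
            (\<forall>s\<in>topspace W. \<forall>t\<in>topspace W.
               q s = q t \<longleftrightarrow> s = t \<or> (\<exists>z\<in>sphere 0 1. {s, t} = {(False, d z), (True, e z)}))"
    using assms(1) unfolding connected_sum_def by blast
  moreover from this(5) have "let W = sum_topology
                   (\<lambda>b. if b then subtopology Y (topspace Y - e ` ball 0 1)
                        else subtopology X (topspace X - d ` ball 0 1)) UNIV
         in quotient_map W Z' (f \<circ> q) \<and>
            (\<forall>s\<in>topspace W. \<forall>t\<in>topspace W.
               (f \<circ> q) s = (f \<circ> q) t \<longleftrightarrow> s = t \<or> (\<exists>z\<in>sphere 0 1. {s, t} = {(False, d z), (True, e z)}))"
    unfolding Let_def by (intro *) (rule conjunct1 conjunct2, assumption)+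
  ultimately show ?thesis
    unfolding connected_sum_def by (intro exI conjI)
qed

text \<open>A case distinction on the last rule is enough: the homeomorphism is composed with the
  outermost quotient map, and the surfaces glued before stay as they are.\<close>

lemma nonorientable_surface_homeomorphic:
  fixes S S' :: "'a topology"
  assumes "nonorientable_surface h S" "S homeomorphic_space S'"
  shows "nonorientable_surface h S'"
  using assms(1)
proof cases
  case one
  then show ?thesis
    using nonorientable_surface.one[OF projective_plane_homeomorphic[OF _ assms(2)]] by simp
next
  case (step k R P)
  then show ?thesis
    using nonorientable_surface.step[OF step(2,3) connected_sum_homeomorphic[OF step(4) assms(2)]] by simp
qed

section \<open>A triangulated projective plane\<close>

text \<open>
  Subdivide every triangle of the octahedron by its edge midpoints and identify antipodes.  The
  vertices are the three axes \<open>0, 1, 2\<close>, together with the midpoints \<open>xy\<close>, \<open>xz\<close>, \<open>yz\<close> of the edges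
  between two axes, where the flag says whether the two coordinates have the same sign.
\<close>

definition xy :: "bool \<Rightarrow> nat" where "xy s = (if s then 3 else 4)"
definition xz :: "bool \<Rightarrow> nat" where "xz t = (if t then 5 else 6)"
definition yz :: "bool \<Rightarrow> nat" where "yz u = (if u then 7 else 8)"

text \<open>The pairs (s, t) are the octants up to the antipodal map, with first coordinate
  nonnegative and signs s and t of the other two; the last two coordinates have the same sign iff s
  = t. The subdivision is needed to obtain a complex: in the quotient of the octahedron itself all
  four triangles have the same three vertices.\<close>

definition hemi_octahedron :: "nat set set" where
  "hemi_octahedron = (\<Union>s. \<Union>t. {{0, xy s, xz t}, {1, xy s, yz (s = t)}, {2, xz t, yz (s = t)},
     {xy s, xz t, yz (s = t)}})"

text \<open>The barycentric coordinate of an edge midpoint, and its value on the octants touching the edge.\<close>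

definition edge_weight :: "real \<Rightarrow> real \<Rightarrow> real \<Rightarrow> real" where
  "edge_weight x y z = max 0 (min (\<bar>x + y\<bar> - \<bar>x - y\<bar>) (\<bar>x + y\<bar> - \<bar>z\<bar>))"

definition edge_value :: "real \<Rightarrow> real \<Rightarrow> real \<Rightarrow> real" where
  "edge_value a b c = max 0 (min (min (2 * a) (2 * b)) (a + b - c))"

text \<open>For equal signs the difference of the two absolute values is twice the smaller of |x|
  and |y|; for opposite signs it is at most 0 and \<open>max\<close> cuts it off. The weight thus
  selects the octants without a case distinction, and its continuity is immediate.\<close>

lemma edge_weight_sign:
  assumes "0 \<le> a" "0 \<le> b"
  shows "edge_weight a b z = edge_value a b \<bar>z\<bar>" "edge_weight (- a) (- b) z = edge_value a b \<bar>z\<bar>"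
    "edge_weight a (- b) z = 0" "edge_weight (- a) b z = 0"
  using assms unfolding edge_weight_def edge_value_def by (auto simp: max_def min_def abs_if)

text \<open>Barycentric coordinates in the subdivided octahedron, extended homogeneously of degree
  one: the total weight is |x| + |y| + |z|. Of the two midpoints belonging to a pair of axes, the
  odd label stands for equal signs, the even one for opposite signs.\<close>

definition octahedral :: "real \<Rightarrow> real \<Rightarrow> real \<Rightarrow> nat \<Rightarrow> real" where
  "octahedral x y z v = (if v = 0 then max 0 (\<bar>x\<bar> - \<bar>y\<bar> - \<bar>z\<bar>) else if v = 1 then max 0 (\<bar>y\<bar> - \<bar>x\<bar> - \<bar>z\<bar>)
     else if v = 2 then max 0 (\<bar>z\<bar> - \<bar>x\<bar> - \<bar>y\<bar>)
     else if v = 3 then edge_weight x y z else if v = 4 then edge_weight x (- y) z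
     else if v = 5 then edge_weight x z y else if v = 6 then edge_weight x (- z) y
     else if v = 7 then edge_weight y z x else if v = 8 then edge_weight y (- z) x else 0)"

abbreviation signed :: "bool \<Rightarrow> real \<Rightarrow> real" where
  "signed s b \<equiv> if s then b else - b"

lemma octahedral_octant:
  assumes "0 \<le> a" "0 \<le> b" "0 \<le> c"
  shows "octahedral a (signed s b) (signed t c) v =
    (if v = 0 then max 0 (a - b - c) else if v = 1 then max 0 (b - a - c) else if v = 2 then max 0 (c - a - b)
     else if v = xy s then edge_value a b c else if v = xz t then edge_value a c b
     else if v = yz (s = t) then edge_value b c a else 0)"
proof (cases "v \<in> {0, 1, 2, 3, 4, 5, 6, 7, 8}")
  case True
  then show ?thesis
    using assms unfolding octahedral_def xy_def xz_def yz_def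
    by (elim insertE emptyE; cases s; cases t; simp add: edge_weight_sign)
next
  case False
  then show ?thesis
    by (simp add: octahedral_def xy_def xz_def yz_def)
qed

lemma octahedral_minus: "octahedral (- x) (- y) (- z) v = octahedral x y z v"
proof -
  have *: "edge_weight (- x) (- y) (- z) = edge_weight x y z" for x y z
    using abs_minus_cancel[of "x + y"] abs_minus_cancel[of "x - y"]
    unfolding edge_weight_def by (simp add: algebra_simps)
  show ?thesis
    unfolding octahedral_def abs_minus_cancel * ..
qed

lemma vertex_distinct [simp]:
  "xy s \<noteq> 0" "xy s \<noteq> Suc 0" "xy s \<noteq> 2" "xz t \<noteq> 0" "xz t \<noteq> Suc 0" "xz t \<noteq> 2" "yz u \<noteq> 0" "yz u \<noteq> Suc 0" "yz u \<noteq> 2"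
  "xy s \<noteq> xz t" "xy s \<noteq> yz u" "xz t \<noteq> xy s" "xz t \<noteq> yz u" "yz u \<noteq> xy s" "yz u \<noteq> xz t"
  "Suc 0 \<noteq> xy s" "2 \<noteq> xy s" "Suc 0 \<noteq> xz t" "2 \<noteq> xz t" "Suc 0 \<noteq> yz u" "2 \<noteq> yz u"
  by (auto simp: xy_def xz_def yz_def)

lemma xyz_inject [simp]: "xy s = xy s' \<longleftrightarrow> s = s'" "xz s = xz s' \<longleftrightarrow> s = s'" "yz s = yz s' \<longleftrightarrow> s = s'"
  by (auto simp: xy_def xz_def yz_def)

text \<open>The first three cases are the corner triangles of a subdivided face, the last is the middle one.\<close>

lemma octahedral_regions:
  assumes "0 \<le> a" "0 \<le> b" "0 \<le> c"
  shows
    "b + c \<le> a \<Longrightarrow> octahedral a (signed s b) (signed t c) v =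
      (if v = 0 then a - b - c else if v = xy s then 2 * b else if v = xz t then 2 * c else 0)"
    "a + c \<le> b \<Longrightarrow> octahedral a (signed s b) (signed t c) v =
      (if v = 1 then b - a - c else if v = xy s then 2 * a else if v = yz (s = t) then 2 * c else 0)"
    "a + b \<le> c \<Longrightarrow> octahedral a (signed s b) (signed t c) v =
      (if v = 2 then c - a - b else if v = xz t then 2 * a else if v = yz (s = t) then 2 * b else 0)"
    "a \<le> b + c \<Longrightarrow> b \<le> a + c \<Longrightarrow> c \<le> a + b \<Longrightarrow> octahedral a (signed s b) (signed t c) v =
      (if v = xy s then a + b - c else if v = xz t then a + c - b else if v = yz (s = t) then b + c - a else 0)"
proof -
  have 1: "max 0 (a - b - c) = a - b - c" "max 0 (b - a - c) = 0" "max 0 (c - a - b) = 0"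
    "edge_value a b c = 2 * b" "edge_value a c b = 2 * c" "edge_value b c a = 0" if "b + c \<le> a"
    using that assms by (auto simp: edge_value_def)
  have 2: "max 0 (a - b - c) = 0" "max 0 (b - a - c) = b - a - c" "max 0 (c - a - b) = 0"
    "edge_value a b c = 2 * a" "edge_value a c b = 0" "edge_value b c a = 2 * c" if "a + c \<le> b"
    using that assms by (auto simp: edge_value_def)
  have 3: "max 0 (a - b - c) = 0" "max 0 (b - a - c) = 0" "max 0 (c - a - b) = c - a - b"
    "edge_value a b c = 0" "edge_value a c b = 2 * a" "edge_value b c a = 2 * b" if "a + b \<le> c"
    using that assms by (auto simp: edge_value_def)
  have 4: "max 0 (a - b - c) = 0" "max 0 (b - a - c) = 0" "max 0 (c - a - b) = 0"
    "edge_value a b c = a + b - c" "edge_value a c b = a + c - b" "edge_value b c a = b + c - a"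
    if "a \<le> b + c" "b \<le> a + c" "c \<le> a + b"
    using that assms by (auto simp: edge_value_def)
  note octant = octahedral_octant[OF assms, of s t v]
  show "b + c \<le> a \<Longrightarrow> octahedral a (signed s b) (signed t c) v =
      (if v = 0 then a - b - c else if v = xy s then 2 * b else if v = xz t then 2 * c else 0)"
    unfolding octant by (simp add: 1)
  show "a + c \<le> b \<Longrightarrow> octahedral a (signed s b) (signed t c) v =
      (if v = 1 then b - a - c else if v = xy s then 2 * a else if v = yz (s = t) then 2 * c else 0)"
    unfolding octant by (simp add: 2)
  show "a + b \<le> c \<Longrightarrow> octahedral a (signed s b) (signed t c) v =
      (if v = 2 then c - a - b else if v = xz t then 2 * a else if v = yz (s = t) then 2 * b else 0)"
    unfolding octant by (simp add: 3)
  show "a \<le> b + c \<Longrightarrow> b \<le> a + c \<Longrightarrow> c \<le> a + b \<Longrightarrow> octahedral a (signed s b) (signed t c) v =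
      (if v = xy s then a + b - c else if v = xz t then a + c - b else if v = yz (s = t) then b + c - a else 0)"
    unfolding octant by (simp add: 4)
qed

lemma region_cases:
  fixes a b c :: real
  obtains "b + c \<le> a" | "a + c \<le> b" | "a + b \<le> c" | "a \<le> b + c" "b \<le> a + c" "c \<le> a + b"
  by linarith

lemma abstract_hemi_octahedron: "abstract_complex (complex_of hemi_octahedron)"
  by (rule abstract_complex_of) (auto simp: hemi_octahedron_def)

lemma octahedral_in_hemi_octahedron:
  assumes abc: "0 \<le> a" "0 \<le> b" "0 \<le> c" "0 < a + b + c"
  shows "(\<lambda>v. octahedral a (signed s b) (signed t c) v / (a + b + c)) \<in> underlying_space (complex_of hemi_octahedron)"
proof -
  define w where "w = (\<lambda>v. octahedral a (signed s b) (signed t c) v / (a + b + c))"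
  have *: ?thesis if T: "T \<in> hemi_octahedron" "finite T" "\<And>v. v \<notin> T \<Longrightarrow> w v = 0" "\<And>v. 0 \<le> w v" "sum w T = 1" for T
  proof -
    have "w \<in> closed_simplex T"
      using T by (auto simp: closed_simplex_def)
    moreover have "T \<in> complex_of hemi_octahedron"
      using T by (intro complex_ofI[of _ T]) auto
    ultimately show ?thesis
      unfolding underlying_space_Union[OF abstract_hemi_octahedron] w_def[symmetric] by blast
  qed
  show ?thesis
  proof (cases rule: region_cases[of b c a])
    case 1
    show ?thesis
      by (rule *[of "{0, xy s, xz t}"])
         (use 1 abc in \<open>auto simp: hemi_octahedron_def w_def octahedral_regions(1)[OF abc(1-3) 1] divide_simps\<close>)
  next
    case 2
    show ?thesis
      by (rule *[of "{1, xy s, yz (s = t)}"])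
         (use 2 abc in \<open>auto simp: hemi_octahedron_def w_def octahedral_regions(2)[OF abc(1-3) 2] divide_simps\<close>)
  next
    case 3
    show ?thesis
      by (rule *[of "{2, xz t, yz (s = t)}"])
         (use 3 abc in \<open>auto simp: hemi_octahedron_def w_def octahedral_regions(3)[OF abc(1-3) 3] divide_simps\<close>)
  next
    case 4
    show ?thesis
      by (rule *[of "{xy s, xz t, yz (s = t)}"])
         (use 4 abc in \<open>auto simp: hemi_octahedron_def w_def octahedral_regions(4)[OF abc(1-3) 4] divide_simps\<close>)
  qed
qed

text \<open>Replacing each midpoint by the average of its two ends gives the preimage: half of its
  weight goes to either end. The factor k stays free so that the point can be scaled to the unit
  sphere later.\<close>

lemma hemi_octahedron_in_octahedral:
  assumes w: "w \<in> underlying_space (complex_of hemi_octahedron)"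
  obtains s t a b c where "0 \<le> a" "0 \<le> b" "0 \<le> c" "a + b + c = 1"
    "\<forall>k>0. \<forall>v. octahedral (a * k) (signed s (b * k)) (signed t (c * k)) v = k * w v"
proof -
  obtain \<sigma> where \<sigma>: "\<sigma> \<in> complex_of hemi_octahedron" "w \<in> closed_simplex \<sigma>"
    using w underlying_space_Union[OF abstract_hemi_octahedron] by auto
  obtain T where T: "T \<in> hemi_octahedron" "\<sigma> \<subseteq> T" using \<sigma>(1) by (rule complex_ofE)
  have fT: "finite T" using T by (auto simp: hemi_octahedron_def)
  have w0: "0 \<le> w v" for v using \<sigma>(2) by (simp add: closed_simplex_def)
  have wT: "w v = 0" if "v \<notin> T" for v using \<sigma>(2) T that by (auto simp: closed_simplex_def)
  have "sum w \<sigma> = sum w T"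
    using \<sigma>(2) T fT by (intro sum.mono_neutral_left) (auto simp: closed_simplex_def)
  then have sT: "sum w T = 1" using \<sigma>(2) by (simp add: closed_simplex_def)
  obtain s t where "T = {0, xy s, xz t} \<or> T = {1, xy s, yz (s = t)} \<or> T = {2, xz t, yz (s = t)} \<or>
      T = {xy s, xz t, yz (s = t)}"
    using T(1) unfolding hemi_octahedron_def by blast
  then show thesis
  proof (elim disjE)
    assume T: "T = {0, xy s, xz t}"
    show thesis
    proof (rule that[of "w 0 + (w (xy s) + w (xz t)) / 2" "w (xy s) / 2" "w (xz t) / 2" s t])
      show "\<forall>k>0. \<forall>v. octahedral ((w 0 + (w (xy s) + w (xz t)) / 2) * k) (signed s (w (xy s) / 2 * k)) (signed t (w (xz t) / 2 * k)) v = k * w v"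
      proof (intro allI impI)
        fix k :: real and v assume "0 < k"
        then have "0 \<le> k * w u" for u using w0 by simp
        then show "octahedral ((w 0 + (w (xy s) + w (xz t)) / 2) * k) (signed s (w (xy s) / 2 * k)) (signed t (w (xz t) / 2 * k)) v = k * w v"
          using wT[of v] T by (subst octahedral_regions(1)) (auto simp: algebra_simps add_divide_distrib)
      qed
    qed (use w0 sT T in \<open>auto simp: field_simps\<close>)
  next
    assume T: "T = {1, xy s, yz (s = t)}"
    show thesis
    proof (rule that[of "w (xy s) / 2" "w 1 + (w (xy s) + w (yz (s = t))) / 2" "w (yz (s = t)) / 2" s t])
      show "\<forall>k>0. \<forall>v. octahedral (w (xy s) / 2 * k) (signed s ((w 1 + (w (xy s) + w (yz (s = t))) / 2) * k)) (signed t (w (yz (s = t)) / 2 * k)) v = k * w v"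
      proof (intro allI impI)
        fix k :: real and v assume "0 < k"
        then have "0 \<le> k * w u" for u using w0 by simp
        then show "octahedral (w (xy s) / 2 * k) (signed s ((w 1 + (w (xy s) + w (yz (s = t))) / 2) * k)) (signed t (w (yz (s = t)) / 2 * k)) v = k * w v"
          using wT[of v] T by (subst octahedral_regions(2)) (auto simp: algebra_simps add_divide_distrib)
      qed
    qed (use w0 sT T in \<open>auto simp: field_simps\<close>)
  next
    assume T: "T = {2, xz t, yz (s = t)}"
    show thesis
    proof (rule that[of "w (xz t) / 2" "w (yz (s = t)) / 2" "w 2 + (w (xz t) + w (yz (s = t))) / 2" s t])
      show "\<forall>k>0. \<forall>v. octahedral (w (xz t) / 2 * k) (signed s (w (yz (s = t)) / 2 * k)) (signed t ((w 2 + (w (xz t) + w (yz (s = t))) / 2) * k)) v = k * w v"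
      proof (intro allI impI)
        fix k :: real and v assume "0 < k"
        then have "0 \<le> k * w u" for u using w0 by simp
        then show "octahedral (w (xz t) / 2 * k) (signed s (w (yz (s = t)) / 2 * k)) (signed t ((w 2 + (w (xz t) + w (yz (s = t))) / 2) * k)) v = k * w v"
          using wT[of v] T by (subst octahedral_regions(3)) (auto simp: algebra_simps add_divide_distrib)
      qed
    qed (use w0 sT T in \<open>auto simp: field_simps\<close>)
  next
    assume T: "T = {xy s, xz t, yz (s = t)}"
    show thesis
    proof (rule that[of "(w (xy s) + w (xz t)) / 2" "(w (xy s) + w (yz (s = t))) / 2" "(w (xz t) + w (yz (s = t))) / 2" s t])
      show "\<forall>k>0. \<forall>v. octahedral ((w (xy s) + w (xz t)) / 2 * k) (signed s ((w (xy s) + w (yz (s = t))) / 2 * k)) (signed t ((w (xz t) + w (yz (s = t))) / 2 * k)) v = k * w v"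
      proof (intro allI impI)
        fix k :: real and v assume "0 < k"
        then have "0 \<le> k * w u" for u using w0 by simp
        then show "octahedral ((w (xy s) + w (xz t)) / 2 * k) (signed s ((w (xy s) + w (yz (s = t))) / 2 * k)) (signed t ((w (xz t) + w (yz (s = t))) / 2 * k)) v = k * w v"
          using wT[of v] T by (subst octahedral_regions(4)) (auto simp: algebra_simps add_divide_distrib)
      qed
    qed (use w0 sT T in \<open>auto simp: field_simps\<close>)
  qed
qed

text \<open>The averaging of midpoints again, now as a left inverse: an axis regains half of the
  weight of each midpoint next to it. Adding both midpoints of a pair of axes makes the formula
  independent of the signs.\<close>

lemma octahedral_abs:
  fixes f :: "nat \<Rightarrow> real"
  assumes abc: "0 \<le> a" "0 \<le> b" "0 \<le> c" and f: "f = octahedral a (signed s b) (signed t c)"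
  shows "a = f 0 + (f 3 + f 4 + f 5 + f 6) / 2" "b = f 1 + (f 3 + f 4 + f 7 + f 8) / 2"
    "c = f 2 + (f 5 + f 6 + f 7 + f 8) / 2"
proof -
  define u where "u = (s = t)"
  note regions = octahedral_regions[OF abc, of s t, folded u_def f]
  have *: "f 3 + f 4 = f (xy s) + f (xy (\<not> s))" "f 5 + f 6 = f (xz t) + f (xz (\<not> t))"
    "f 7 + f 8 = f (yz u) + f (yz (\<not> u))"
    by (auto simp: xy_def xz_def yz_def)
  have "2 * a = 2 * f 0 + ((f (xy s) + f (xy (\<not> s))) + (f (xz t) + f (xz (\<not> t)))) \<and>
    2 * b = 2 * f 1 + ((f (xy s) + f (xy (\<not> s))) + (f (yz u) + f (yz (\<not> u)))) \<and>
    2 * c = 2 * f 2 + ((f (xz t) + f (xz (\<not> t))) + (f (yz u) + f (yz (\<not> u))))"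
    by (rule region_cases[of b c a]; simp add: regions)
  then show "a = f 0 + (f 3 + f 4 + f 5 + f 6) / 2" "b = f 1 + (f 3 + f 4 + f 7 + f 8) / 2"
    "c = f 2 + (f 5 + f 6 + f 7 + f 8) / 2"
    unfolding *[symmetric] by (auto simp: field_simps)
qed

text \<open>If a > 0, the positive midpoint weights reveal the sign of every nonzero coordinate,
  directly or through the truth value of s = t. If a = 0, only the relative sign of the other two
  coordinates is visible, which leaves the antipodal point as the single alternative.\<close>

lemma octahedral_signs:
  assumes abc: "0 \<le> a" "0 \<le> b" "0 \<le> c"
    and eq: "\<And>v. octahedral a (signed s b) (signed t c) v = octahedral a (signed s' b) (signed t' c) v"
  shows "(signed s b = signed s' b \<and> signed t c = signed t' c) \<or>
    (a = 0 \<and> signed s b = - signed s' b \<and> signed t c = - signed t' c)"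
proof (cases rule: region_cases[of b c a])
  case 1
  then show ?thesis
    using eq[of "xy s"] eq[of "xz t"] by (auto simp: octahedral_regions(1)[OF abc 1] split: if_splits)
next
  case 2
  then show ?thesis
    using eq[of "xy s"] eq[of "yz (s = t)"] by (auto simp: octahedral_regions(2)[OF abc 2] split: if_splits)
next
  case 3
  then show ?thesis
    using eq[of "xz t"] eq[of "yz (s = t)"] by (auto simp: octahedral_regions(3)[OF abc 3] split: if_splits)
next
  case 4
  then show ?thesis
    using eq[of "xy s"] eq[of "xz t"] eq[of "yz (s = t)"] abc
    by (auto simp: octahedral_regions(4)[OF abc 4] split: if_splits)
qed

text \<open>By homogeneity, dividing by the sum of the absolute values has the effect of first
  projecting the sphere radially onto the octahedron.\<close>

definition octahedral_map :: "real^3 \<Rightarrow> nat \<Rightarrow> real" where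
  "octahedral_map p v = octahedral (p$1) (p$2) (p$3) v / (\<bar>p$1\<bar> + \<bar>p$2\<bar> + \<bar>p$3\<bar>)"

lemma octahedral_map_minus: "octahedral_map (- p) = octahedral_map p"
  by (simp add: octahedral_map_def octahedral_minus fun_eq_iff)

lemma octant_cases:
  fixes p :: "real^3"
  obtains s t a b c where "0 \<le> a" "0 \<le> b" "0 \<le> c"
    "p = vector [a, signed s b, signed t c] \<or> p = - vector [a, signed s b, signed t c]"
proof -
  \<comment> \<open>The sign that makes the first coordinate of \<open>e *\<^sub>R p\<close>
    nonnegative.\<close>
  define e :: real where "e = (if 0 \<le> p$1 then 1 else -1)"
  have "p = e *\<^sub>R vector [\<bar>p$1\<bar>, signed (0 \<le> e * p$2) \<bar>p$2\<bar>, signed (0 \<le> e * p$3) \<bar>p$3\<bar>]"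
    by (auto simp: vec_eq_iff forall_3 e_def)
  then show thesis
    by (intro that[of "\<bar>p$1\<bar>" "\<bar>p$2\<bar>" "\<bar>p$3\<bar>" "0 \<le> e * p$2" "0 \<le> e * p$3"]) (auto simp: e_def split: if_splits)
qed

lemma octahedral_map_octant:
  assumes "0 \<le> a" "0 \<le> b" "0 \<le> c"
  shows "octahedral_map (vector [a, signed s b, signed t c]) =
    (\<lambda>v. octahedral a (signed s b) (signed t c) v / (a + b + c))"
  using assms by (auto simp: octahedral_map_def fun_eq_iff)

lemma norm_eq_1_vector_3: "norm (vector [x, y, z] :: real^3) = 1 \<longleftrightarrow> x\<^sup>2 + y\<^sup>2 + z\<^sup>2 = 1"
  by (simp add: norm_vec_def L2_set_def sum_3)

lemma octahedral_map_octant_eq_iff: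
  assumes abc: "0 \<le> a" "0 \<le> b" "0 \<le> c" "a\<^sup>2 + b\<^sup>2 + c\<^sup>2 = 1"
    and abc': "0 \<le> a'" "0 \<le> b'" "0 \<le> c'" "a'\<^sup>2 + b'\<^sup>2 + c'\<^sup>2 = 1"
    and eq: "octahedral_map (vector [a, signed s b, signed t c]) = octahedral_map (vector [a', signed s' b', signed t' c'])"
  shows "(vector [a, signed s b, signed t c] :: real^3) = vector [a', signed s' b', signed t' c'] \<or>
    (vector [a, signed s b, signed t c] :: real^3) = - vector [a', signed s' b', signed t' c']"
proof -
  define S S' where "S = a + b + c" and "S' = a' + b' + c'"
  have S: "0 < S" "0 < S'"
    unfolding S_def S'_def using abc abc'
    by (smt (verit) power_zero_numeral)+
  have eq': "octahedral a (signed s b) (signed t c) v / S = octahedral a' (signed s' b') (signed t' c') v / S'" for v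
    using fun_cong[OF eq, of v]
    unfolding octahedral_map_octant[OF abc(1-3)] octahedral_map_octant[OF abc'(1-3)] S_def S'_def by simp
  \<comment> \<open>Equal images make the absolute values of the coordinates proportional with
    factor k; both points have Euclidean norm 1, so k = 1.\<close>
  define k where "k = S / S'"
  have k: "0 < k" using S by (simp add: k_def)
  have ov: "octahedral a (signed s b) (signed t c) v = k * octahedral a' (signed s' b') (signed t' c') v" for v
    using eq'[of v] S by (simp add: k_def field_simps)
  note A = octahedral_abs[OF abc(1-3) refl, of s t] and A' = octahedral_abs[OF abc'(1-3) refl, of s' t']
  have abck: "a = k * a'" "b = k * b'" "c = k * c'"
    by (subst A, subst A', simp only: ov, simp add: algebra_simps)+
  have "k\<^sup>2 * (a'\<^sup>2 + b'\<^sup>2 + c'\<^sup>2) = 1"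
    using abc(4) unfolding abck by (simp add: power_mult_distrib distrib_left)
  then have "k = 1"
    using abc'(4) k by (simp add: power2_eq_1_iff)
  then have same: "a = a'" "b = b'" "c = c'" using abck by auto
  have "(signed s b = signed s' b \<and> signed t c = signed t' c) \<or>
    (a = 0 \<and> signed s b = - signed s' b \<and> signed t c = - signed t' c)"
    by (rule octahedral_signs[OF abc(1-3)]) (use ov same \<open>k = 1\<close> in simp)
  then show ?thesis
    unfolding same by (auto simp: vec_eq_iff forall_3)
qed

lemma continuous_on_octahedral_map: "continuous_on (sphere 0 1) octahedral_map"
proof (rule continuous_on_coordinatewise_then_product)
  fix v
  have ew: "continuous_on S (\<lambda>p. edge_weight (f p) (g p) (h p))"
    if "continuous_on S f" "continuous_on S g" "continuous_on S h" for S :: "(real^3) set" and f g h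
    unfolding edge_weight_def using that by (intro continuous_intros)
  have oc: "continuous_on S (\<lambda>p. octahedral (p$1) (p$2) (p$3) v)" for S :: "(real^3) set"
  proof (cases "v \<in> {0, 1, 2, 3, 4, 5, 6, 7, 8}")
    case True
    then show ?thesis
      unfolding octahedral_def by (elim insertE emptyE; simp; intro continuous_intros ew)
  next
    case False
    then show ?thesis by (simp add: octahedral_def)
  qed
  have "\<bar>p$1\<bar> + \<bar>p$2\<bar> + \<bar>p$3\<bar> \<noteq> 0" if "p \<in> sphere 0 1" for p :: "real^3"
  proof
    assume "\<bar>p$1\<bar> + \<bar>p$2\<bar> + \<bar>p$3\<bar> = 0"
    then have "p = 0" by (simp add: vec_eq_iff forall_3) linarith
    then show False using that by simp
  qed
  then show "continuous_on (sphere 0 1) (\<lambda>p. octahedral_map p v)"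
    unfolding octahedral_map_def by (intro continuous_intros oc) auto
qed

lemma projective_plane_hemi_octahedron:
  "projective_plane (top_of_set (underlying_space (complex_of hemi_octahedron)))"
proof -
  let ?K = "underlying_space (complex_of hemi_octahedron)"
  have pos: "0 < a + b + c" if "0 \<le> a" "0 \<le> b" "0 \<le> c" "a\<^sup>2 + b\<^sup>2 + c\<^sup>2 = 1" for a b c :: real
    using that by (smt (verit) power_zero_numeral)
  have sgn: "(signed s b)\<^sup>2 = b\<^sup>2" for s b by simp
  have into: "octahedral_map p \<in> ?K" if "p \<in> sphere 0 1" for p
  proof -
    obtain s t a b c where p: "0 \<le> a" "0 \<le> b" "0 \<le> c"
      "p = vector [a, signed s b, signed t c] \<or> p = - vector [a, signed s b, signed t c]"
      by (rule octant_cases)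
    have "norm (vector [a, signed s b, signed t c] :: real^3) = 1"
      using p(4) that by auto
    then have "a\<^sup>2 + b\<^sup>2 + c\<^sup>2 = 1"
      unfolding norm_eq_1_vector_3 sgn .
    moreover have "octahedral_map p = octahedral_map (vector [a, signed s b, signed t c])"
      using p(4) octahedral_map_minus by metis
    ultimately show ?thesis
      using octahedral_in_hemi_octahedron[OF p(1-3) pos[OF p(1-3)]] octahedral_map_octant[OF p(1-3)] by simp
  qed
  have onto: "w \<in> octahedral_map ` sphere 0 1" if w: "w \<in> ?K" for w
  proof -
    obtain s t a b c where p: "0 \<le> a" "0 \<le> b" "0 \<le> c" "a + b + c = 1"
      "\<forall>k>0. \<forall>v. octahedral (a * k) (signed s (b * k)) (signed t (c * k)) v = k * w v"
      by (rule hemi_octahedron_in_octahedral[OF w])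
    define n where "n = sqrt (a\<^sup>2 + b\<^sup>2 + c\<^sup>2)"
    have "a\<^sup>2 + b\<^sup>2 + c\<^sup>2 \<noteq> 0"
      using p(4) by (auto simp: add_nonneg_eq_0_iff)
    then have sq: "0 < a\<^sup>2 + b\<^sup>2 + c\<^sup>2"
      by (simp add: less_le)
    then have n: "0 < n" "n\<^sup>2 = a\<^sup>2 + b\<^sup>2 + c\<^sup>2"
      by (simp_all add: n_def)
    \<comment> \<open>The preimage found on the octahedron, moved along its ray to the
      sphere.\<close>
    define q :: "real^3" where "q = vector [a * (1/n), signed s (b * (1/n)), signed t (c * (1/n))]"
    have "norm q = 1"
      unfolding q_def norm_eq_1_vector_3 sgn using n(1) by (simp add: power_divide add_divide_distrib[symmetric] n(2)[symmetric])
    moreover have "octahedral_map q = w"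
    proof
      fix v
      have "octahedral_map q v = (1/n) * w v / (a * (1/n) + b * (1/n) + c * (1/n))"
      proof -
        have "octahedral (a * (1/n)) (signed s (b * (1/n))) (signed t (c * (1/n))) v = 1/n * w v"
          by (rule p(5)[rule_format]) (use n in simp)
        moreover have "0 \<le> a * (1/n)" "0 \<le> b * (1/n)" "0 \<le> c * (1/n)"
          using p n by simp_all
        ultimately show ?thesis
          unfolding q_def by (simp only: octahedral_map_octant)
      qed
      also have "a * (1/n) + b * (1/n) + c * (1/n) = 1/n"
        unfolding distrib_right[symmetric] p(4) by simp
      finally show "octahedral_map q v = w v" using n by simp
    qed
    ultimately show ?thesis by (intro image_eqI[of _ _ q]) auto
  qed
  have "quotient_map (top_of_set (sphere 0 1)) (top_of_set ?K) octahedral_map"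
  proof (rule continuous_closed_imp_quotient_map)
    show "octahedral_map ` topspace (top_of_set (sphere 0 1)) = topspace (top_of_set ?K)"
      using into onto by auto
    show "continuous_map (top_of_set (sphere 0 1)) (top_of_set ?K) octahedral_map"
      using continuous_on_octahedral_map into by simp
    show "closed_map (top_of_set (sphere 0 1)) (top_of_set ?K) octahedral_map"
      unfolding closed_map_def
    proof (intro allI impI)
      fix U :: "(real^3) set" assume "closedin (top_of_set (sphere 0 1)) U"
      then have U: "compact U" "U \<subseteq> sphere 0 1"
        by (simp_all add: closedin_compact_eq)
      then have "compact (octahedral_map ` U)"
        by (intro compact_continuous_image continuous_on_subset[OF continuous_on_octahedral_map])
      moreover have "octahedral_map ` U \<subseteq> ?K"
        using U(2) into by blast
      ultimately show "closedin (top_of_set ?K) (octahedral_map ` U)"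
        by (intro closed_subset compact_imp_closed)
    qed
  qed
  moreover have "octahedral_map p = octahedral_map q \<longleftrightarrow> p = q \<or> p = - q"
    if pq: "p \<in> sphere 0 1" "q \<in> sphere 0 1" for p q
  proof
    assume eq: "octahedral_map p = octahedral_map q"
    obtain s t a b c where p: "0 \<le> a" "0 \<le> b" "0 \<le> c"
      "p = vector [a, signed s b, signed t c] \<or> p = - vector [a, signed s b, signed t c]"
      by (rule octant_cases)
    obtain s' t' a' b' c' where q: "0 \<le> a'" "0 \<le> b'" "0 \<le> c'"
      "q = vector [a', signed s' b', signed t' c'] \<or> q = - vector [a', signed s' b', signed t' c']"
      by (rule octant_cases)
    have "norm (vector [a, signed s b, signed t c] :: real^3) = 1"
      "norm (vector [a', signed s' b', signed t' c'] :: real^3) = 1"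
      using p(4) q(4) pq by auto
    then have n: "a\<^sup>2 + b\<^sup>2 + c\<^sup>2 = 1" "a'\<^sup>2 + b'\<^sup>2 + c'\<^sup>2 = 1"
      unfolding norm_eq_1_vector_3 sgn by simp_all
    have "octahedral_map (vector [a, signed s b, signed t c]) = octahedral_map (vector [a', signed s' b', signed t' c'])"
      using eq p(4) q(4) octahedral_map_minus by metis
    from octahedral_map_octant_eq_iff[OF p(1-3) n(1) q(1-3) n(2) this]
    show "p = q \<or> p = - q"
      using p(4) q(4) by (metis minus_minus)
  qed (auto simp: octahedral_map_minus)
  ultimately show ?thesis
    unfolding projective_plane_def by blast
qed

section \<open>Surfaces given by lists of triangles\<close>

definition spanned :: "nat list list \<Rightarrow> nat set set" where
  "spanned ts = complex_of (set ` set ts)"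

abbreviation polyhedron :: "nat list list \<Rightarrow> (nat \<Rightarrow> real) topology" where
  "polyhedron ts \<equiv> top_of_set (underlying_space (spanned ts))"

definition included :: "nat list \<Rightarrow> nat list \<Rightarrow> bool" where
  "included xs ys \<longleftrightarrow> (\<forall>x\<in>set xs. x \<in> set ys)"

text \<open>The facets of the simplex on A and B that omit one vertex of B, that is, the join of A
  with the boundary of B. Sorting gives each triangle one list as its name.\<close>

definition drop_each :: "nat list \<Rightarrow> nat list \<Rightarrow> nat list list" where
  "drop_each A B = map (\<lambda>b. remove1 b (sort (A @ B))) B"

text \<open>A result \<open>Some us\<close> certifies the assumptions of
  \<open>exchange_complex_of\<close>: the two inclusions between S and N say that the link of A is
  the boundary of B, and B must not be a face. Evaluating a sequence of moves therefore proves the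
  homeomorphism.\<close>

definition move :: "nat list \<Rightarrow> nat list \<Rightarrow> nat list list \<Rightarrow> nat list list option" where
  "move A B ts =
    (let S = filter (included A) ts; N = drop_each A B in
     if A \<noteq> [] \<and> B \<noteq> [] \<and> distinct (A @ B) \<and> (\<forall>t\<in>set ts. \<not> included B t) \<and>
       (\<forall>t\<in>set S. t \<in> set N) \<and> (\<forall>t\<in>set N. t \<in> set S)
     then Some (drop_each B A @ filter (\<lambda>t. \<not> included A t) ts) else None)"

fun moves :: "(nat list \<times> nat list) list \<Rightarrow> nat list list \<Rightarrow> nat list list option" where
  "moves [] ts = Some ts"
| "moves ((A, B) # ms) ts = (case move A B ts of None \<Rightarrow> None | Some us \<Rightarrow> moves ms us)"

lemma abstract_spanned: "abstract_complex (spanned ts)"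
  unfolding spanned_def by (rule abstract_complex_of) auto

lemma spannedE:
  assumes "\<sigma> \<in> spanned ts"
  obtains t where "t \<in> set ts" "\<sigma> \<subseteq> set t"
  using assms unfolding spanned_def by (elim complex_ofE) blast

lemma included_iff: "included xs ys \<longleftrightarrow> set xs \<subseteq> set ys"
  by (auto simp: included_def)

lemma set_drop_each:
  assumes "distinct (A @ B)"
  shows "set ` set (drop_each A B) = (\<lambda>b. set A \<union> set B - {b}) ` set B"
proof -
  have "distinct (sort (A @ B))" using assms by simp
  then show ?thesis
    by (simp add: drop_each_def image_image set_remove1_eq)
qed

lemma if_Some_eq_SomeD: "(if C then Some u else None) = Some v \<Longrightarrow> C \<and> v = u"
  by (simp split: if_splits)

lemma move_homeomorphic:
  assumes "move A B ts = Some us"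
  shows "polyhedron ts homeomorphic_space polyhedron us"
proof -
  have *: "A \<noteq> []" "B \<noteq> []" "distinct (A @ B)" "\<forall>t\<in>set ts. \<not> included B t"
    "set (filter (included A) ts) = set (drop_each A B)"
    "us = drop_each B A @ filter (\<lambda>t. \<not> included A t) ts"
  proof -
    note C = if_Some_eq_SomeD[OF assms[unfolded move_def Let_def]]
    then show "A \<noteq> []" "B \<noteq> []" "distinct (A @ B)" "\<forall>t\<in>set ts. \<not> included B t"
      "us = drop_each B A @ filter (\<lambda>t. \<not> included A t) ts"
      by (elim conjE; simp only:)+
    show "set (filter (included A) ts) = set (drop_each A B)"
      using C by (intro equalityI subsetI) (elim conjE; erule (1) bspec)+
  qed
  let ?F = "set ` set ts" and ?A = "set A" and ?B = "set B"
  have F: "{t \<in> ?F. ?A \<subseteq> t} = (\<lambda>b. ?A \<union> ?B - {b}) ` ?B"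
    unfolding set_drop_each[OF *(3), symmetric] *(5)[symmetric] by (auto simp: included_iff)
  have B: "\<not> ?B \<subseteq> t" if "t \<in> ?F" for t
    using that *(4) by (auto simp: included_iff)
  have "distinct (B @ A)" using *(3) by auto
  then have "set ` set us = {t \<in> ?F. \<not> ?A \<subseteq> t} \<union> (\<lambda>a. ?A \<union> ?B - {a}) ` ?A"
    unfolding *(6) set_append image_Un set_drop_each[OF \<open>distinct (B @ A)\<close>]
    by (auto simp: included_iff Un_commute)
  then have "exchange ?A ?B (spanned ts) (spanned us)"
    unfolding spanned_def using exchange_complex_of[OF _ _ _ _ _ F B] *(1-3) by simp
  then show ?thesis
    by (rule exchange_homeomorphic) (rule abstract_spanned)+
qed

lemma moves_homeomorphic: "moves ms ts = Some us \<Longrightarrow> polyhedron ts homeomorphic_space polyhedron us"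
proof (induction ms ts rule: moves.induct)
  case (2 A B ms ts)
  then obtain vs where "move A B ts = Some vs" "polyhedron vs homeomorphic_space polyhedron us"
    by (auto split: option.splits)
  then show ?case
    using homeomorphic_space_trans[OF move_homeomorphic] by blast
qed (auto simp: homeomorphic_space_refl)

text \<open>For sorted lists equality of triangles is equality of lists, so that gluing can delete
  the common triangle by comparing lists.\<close>

definition is_triangle :: "nat list \<Rightarrow> bool" where
  "is_triangle t \<longleftrightarrow> length t = 3 \<and> distinct t \<and> sorted t"

definition relabel :: "(nat \<Rightarrow> nat) \<Rightarrow> nat list list \<Rightarrow> nat list list" where
  "relabel f ts = map (\<lambda>t. sort (map f t)) ts"

lemma relabel_list_homeomorphic:
  assumes "distinct (map f (remdups (concat ts)))"
  shows "polyhedron ts homeomorphic_space polyhedron (relabel f ts)"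
proof -
  have "inj_on f (\<Union>(set ` set ts))"
    using assms by (simp add: distinct_map)
  then have "polyhedron ts homeomorphic_space top_of_set (underlying_space (complex_of ((`) f ` set ` set ts)))"
    unfolding spanned_def by (intro relabel_homeomorphic) auto
  moreover have "(`) f ` set ` set ts = set ` set (relabel f ts)"
    by (auto simp: relabel_def image_image)
  ultimately show ?thesis
    by (simp add: spanned_def)
qed

definition glue :: "nat list \<Rightarrow> nat list list \<Rightarrow> nat list list \<Rightarrow> nat list list" where
  "glue t ts us = filter (\<lambda>s. s \<noteq> t) ts @ filter (\<lambda>s. s \<noteq> t) us"

definition gluable :: "nat list \<Rightarrow> nat list list \<Rightarrow> nat list list \<Rightarrow> bool" where
  "gluable t ts us \<longleftrightarrow> (\<forall>s\<in>set ts. is_triangle s) \<and> (\<forall>s\<in>set us. is_triangle s) \<and> t \<in> set ts \<and> t \<in> set us \<and>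
     (\<forall>v\<in>set (concat ts). v \<in> set (concat us) \<longrightarrow> v \<in> set t) \<and>
     (\<forall>v\<in>set t. \<exists>s\<in>set ts. s \<noteq> t \<and> included (remove1 v t) s)"

lemma is_triangle_set_eq:
  assumes "is_triangle s" "is_triangle t"
  shows "set s = set t \<longleftrightarrow> s = t"
  using assms sorted_distinct_set_unique by (auto simp: is_triangle_def)

lemma connected_sum_glue:
  assumes "gluable t ts us"
  shows "connected_sum (polyhedron ts) (polyhedron us) (polyhedron (glue t ts us))"
proof -
  have tri: "is_triangle s" if "s \<in> set ts \<union> set us" for s
    using that assms by (auto simp: gluable_def)
  have t: "t \<in> set ts" "t \<in> set us" "is_triangle t"
    using assms by (auto simp: gluable_def)
  have *: "set ` {s \<in> set xs. s \<noteq> t} = set ` set xs - {set t}" if "set xs \<subseteq> set ts \<union> set us" for xs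
    using is_triangle_set_eq[OF tri t(3)] that by auto
  have "set ` set (glue t ts us) = (set ` set ts - {set t}) \<union> (set ` set us - {set t})"
    by (simp add: glue_def image_Un *)
  moreover have "connected_sum (polyhedron ts) (polyhedron us)
    (top_of_set (underlying_space (complex_of ((set ` set ts - {set t}) \<union> (set ` set us - {set t})))))"
    unfolding spanned_def
  proof (rule connected_sum_complex_of)
    show "card s = 3" if "s \<in> set ` set ts \<union> set ` set us" for s
      using that tri by (auto simp: is_triangle_def distinct_card)
    have "\<forall>v\<in>set (concat ts). v \<in> set (concat us) \<longrightarrow> v \<in> set t"
      using assms unfolding gluable_def by (elim conjE)
    moreover have "set t \<subseteq> set (concat ts)" "set t \<subseteq> set (concat us)"
      using t by auto
    ultimately show "\<Union>(set ` set ts) \<inter> \<Union>(set ` set us) = set t"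
      unfolding set_concat[symmetric] by blast
    show "\<exists>s\<in>set ` set ts - {set t}. set t - {v} \<subseteq> s" if v: "v \<in> set t" for v
    proof -
      obtain s where s: "s \<in> set ts" "s \<noteq> t" "included (remove1 v t) s"
        using assms v by (auto simp: gluable_def)
      then have "set t - {v} \<subseteq> set s"
        using t(3) by (simp add: included_iff is_triangle_def set_remove1_eq)
      moreover have "set s \<noteq> set t"
        using is_triangle_set_eq[OF tri t(3)] s by simp
      ultimately show ?thesis using s(1) by blast
    qed
  qed (use t in auto)
  ultimately show ?thesis
    by (simp add: spanned_def)
qed

text \<open>One entry per added projective plane: the new names of its vertices, indexed by the old
  ones; the triangle along which it is glued; the moves that follow.\<close>

fun attach :: "nat list list \<Rightarrow> (nat list \<times> nat list \<times> (nat list \<times> nat list) list) list \<Rightarrow>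
    nat list list \<Rightarrow> nat list list option" where
  "attach ps [] ts = Some ts"
| "attach ps ((l, t, ms) # xs) ts =
    (if distinct (map ((!) l) (remdups (concat ps))) \<and> gluable t ts (relabel ((!) l) ps)
     then case moves ms (glue t ts (relabel ((!) l) ps)) of None \<Rightarrow> None | Some us \<Rightarrow> attach ps xs us
     else None)"

lemma nonorientable_surface_attach:
  assumes "projective_plane (polyhedron ps)"
  shows "attach ps xs ts = Some us \<Longrightarrow> nonorientable_surface h (polyhedron ts) \<Longrightarrow>
    nonorientable_surface (h + length xs) (polyhedron us)"
  using assms
proof (induction ps xs ts arbitrary: h rule: attach.induct)
  case (2 ps l t ms xs ts)
  let ?ps = "relabel ((!) l) ps"
  obtain vs where vs: "distinct (map ((!) l) (remdups (concat ps)))" "gluable t ts ?ps"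
    "moves ms (glue t ts ?ps) = Some vs" "attach ps xs vs = Some us"
    using 2(2) by (auto split: if_splits option.splits)
  have "projective_plane (polyhedron ?ps)"
    using projective_plane_homeomorphic[OF 2(4) relabel_list_homeomorphic[OF vs(1)]] .
  then have "nonorientable_surface (Suc h) (polyhedron (glue t ts ?ps))"
    using nonorientable_surface.step[OF 2(3) _ connected_sum_glue[OF vs(2)]] by simp
  then have "nonorientable_surface (Suc h) (polyhedron vs)"
    using nonorientable_surface_homeomorphic moves_homeomorphic[OF vs(3)] by blast
  then show ?case
    using 2(1)[OF _ vs(3,4)] vs(1,2) 2(4) by fastforce
qed simp

section \<open>From lists of triangles to triangulations\<close>

lemma vertices_spanned: "vertices (spanned ts) = set (concat ts)"
proof
  show "set (concat ts) \<subseteq> vertices (spanned ts)"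
  proof
    fix v assume "v \<in> set (concat ts)"
    then obtain t where "t \<in> set ts" "v \<in> set t" by auto
    then have "{v} \<in> spanned ts" unfolding spanned_def by (intro complex_ofI[of _ "set t"]) auto
    then show "v \<in> vertices (spanned ts)" by (auto simp: vertices_def)
  qed
qed (auto simp: vertices_def spanned_def complex_of_def)

lemma triangles_spanned:
  assumes "\<forall>t\<in>set ts. is_triangle t"
  shows "{\<sigma> \<in> spanned ts. card \<sigma> = 3} = set ` set ts"
proof (intro set_eqI iffI)
  fix \<sigma> assume "\<sigma> \<in> {\<sigma> \<in> spanned ts. card \<sigma> = 3}"
  then have \<sigma>: "\<sigma> \<in> spanned ts" "card \<sigma> = 3" by auto
  obtain t where t: "t \<in> set ts" "\<sigma> \<subseteq> set t"
    using \<sigma>(1) by (rule spannedE)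
  have "card (set t) = 3" using t(1) assms by (simp add: is_triangle_def distinct_card)
  then have "\<sigma> = set t" using t \<sigma>(2) by (intro card_subset_eq) auto
  then show "\<sigma> \<in> set ` set ts" using t by blast
next
  fix \<sigma> assume "\<sigma> \<in> set ` set ts"
  then obtain t where t: "t \<in> set ts" "\<sigma> = set t" by blast
  then have "card \<sigma> = 3" using assms by (simp add: is_triangle_def distinct_card)
  moreover then have "\<sigma> \<noteq> {}" by auto
  ultimately show "\<sigma> \<in> {\<sigma> \<in> spanned ts. card \<sigma> = 3}"
    using t by (auto simp: spanned_def complex_of_def)
qed

lemma triangulation_of_N_spanned:
  assumes "nonorientable_surface h (polyhedron ts)" "\<forall>t\<in>set ts. is_triangle t" "ts \<noteq> []"
  shows "triangulation_of_N h (spanned ts)"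
proof -
  have "card \<sigma> \<le> 3" if \<sigma>: "\<sigma> \<in> spanned ts" for \<sigma>
  proof -
    obtain t where t: "t \<in> set ts" "\<sigma> \<subseteq> set t"
      using \<sigma> by (rule spannedE)
    then have "card \<sigma> \<le> card (set t)" by (intro card_mono) auto
    also have "\<dots> = 3" using t assms(2) by (simp add: is_triangle_def distinct_card)
    finally show ?thesis .
  qed
  moreover have "\<exists>\<sigma>\<in>spanned ts. card \<sigma> = 3"
    using triangles_spanned[OF assms(2)] assms(3) by (cases ts) auto
  ultimately have "triangulates (spanned ts) (polyhedron ts)"
    unfolding triangulates_def two_dimensional_def
    using abstract_spanned homeomorphic_space_refl by blast
  then show ?thesis
    unfolding triangulation_of_N_def using assms(1) by blast
qed

section \<open>Immersions\<close>

text \<open>Polymorphic, like the tests below, so that the same formula is evaluated over the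
  integers and used over the reals.\<close>

fun det3 :: "'a :: comm_ring_1 \<times> 'a \<times> 'a \<Rightarrow> 'a \<times> 'a \<times> 'a \<Rightarrow> 'a \<times> 'a \<times> 'a \<Rightarrow> 'a" where
  "det3 (a1, a2, a3) (b1, b2, b3) (c1, c2, c3) =
     a1 * (b2 * c3 - b3 * c2) - a2 * (b1 * c3 - b3 * c1) + a3 * (b1 * c2 - b2 * c1)"

text \<open>Up to sign these are the coordinates of the cross product.\<close>

fun independent2 :: "'a :: comm_ring_1 \<times> 'a \<times> 'a \<Rightarrow> 'a \<times> 'a \<times> 'a \<Rightarrow> bool" where
  "independent2 (a1, a2, a3) (b1, b2, b3) \<longleftrightarrow>
     a2 * b3 - a3 * b2 \<noteq> 0 \<or> a1 * b3 - a3 * b1 \<noteq> 0 \<or> a1 * b2 - a2 * b1 \<noteq> 0"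

text \<open>
  Guarantees that the cones spanned by \<open>a, b\<close> and by \<open>c, d\<close> meet only in the origin: if
  \<open>p a + q b = r c + s d\<close> with nonnegative coefficients, taking determinants with two of the four
  vectors leaves linear relations between two of the coefficients each.
\<close>

fun cones_apart :: "'a :: linordered_idom \<times> 'a \<times> 'a \<Rightarrow> 'a \<times> 'a \<times> 'a \<Rightarrow> 'a \<times> 'a \<times> 'a \<Rightarrow> 'a \<times> 'a \<times> 'a \<Rightarrow> bool" where
  "cones_apart a b c d \<longleftrightarrow>
    (let s1 = det3 a b c; s2 = det3 a b d; s3 = det3 c d a; s4 = det3 c d b
     in s1 * s2 > 0 \<or> s3 * s4 > 0 \<or> s1 * s3 > 0 \<or> s2 * s4 > 0)"

fun lincomb2 :: "'a :: comm_ring_1 \<Rightarrow> 'a \<times> 'a \<times> 'a \<Rightarrow> 'a \<Rightarrow> 'a \<times> 'a \<times> 'a \<Rightarrow> 'a \<times> 'a \<times> 'a" where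
  "lincomb2 p (a1, a2, a3) q (b1, b2, b3) = (p * a1 + q * b1, p * a2 + q * b2, p * a3 + q * b3)"

lemma independent2_coeffs:
  fixes a b :: "real \<times> real \<times> real"
  assumes "independent2 a b" "lincomb2 p a q b = lincomb2 r a s b"
  shows "p = r" "q = s"
proof -
  obtain a1 a2 a3 b1 b2 b3 where ab: "a = (a1, a2, a3)" "b = (b1, b2, b3)"
    by (cases a, cases b) auto
  have e: "p * a1 + q * b1 = r * a1 + s * b1" "p * a2 + q * b2 = r * a2 + s * b2" "p * a3 + q * b3 = r * a3 + s * b3"
    using assms(2) by (simp_all add: ab)
  have "(p - r) * (a2 * b3 - a3 * b2) = 0" "(p - r) * (a1 * b3 - a3 * b1) = 0" "(p - r) * (a1 * b2 - a2 * b1) = 0"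
    "(q - s) * (a2 * b3 - a3 * b2) = 0" "(q - s) * (a1 * b3 - a3 * b1) = 0" "(q - s) * (a1 * b2 - a2 * b1) = 0"
    using e by algebra+
  then show "p = r" "q = s"
    using assms(1) by (auto simp: ab)
qed

lemma det3_coeffs:
  fixes a b c :: "real \<times> real \<times> real"
  assumes "det3 a b c \<noteq> 0" "lincomb2 p a q b = lincomb2 r a s c"
  shows "p = r" "q = 0" "s = 0"
proof -
  obtain a1 a2 a3 b1 b2 b3 c1 c2 c3 where abc: "a = (a1, a2, a3)" "b = (b1, b2, b3)" "c = (c1, c2, c3)"
    by (cases a, cases b, cases c) auto
  have e: "p * a1 + q * b1 = r * a1 + s * c1" "p * a2 + q * b2 = r * a2 + s * c2" "p * a3 + q * b3 = r * a3 + s * c3"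
    using assms(2) by (simp_all add: abc)
  have "(p - r) * det3 a b c = 0" "q * det3 a b c = 0" "s * det3 a b c = 0"
    unfolding abc det3.simps using e by algebra+
  then show "p = r" "q = 0" "s = 0" using assms(1) by auto
qed

lemma cones_apart_coeffs:
  fixes a b c d :: "real \<times> real \<times> real"
  assumes apart: "cones_apart a b c d" and eq: "lincomb2 p a q b = lincomb2 r c s d"
    and nonneg: "0 \<le> p" "0 \<le> q" "0 \<le> r" "0 \<le> s"
  shows "p = 0 \<and> q = 0 \<and> r = 0 \<and> s = 0"
proof -
  define s1 s2 s3 s4 where s: "s1 = det3 a b c" "s2 = det3 a b d" "s3 = det3 c d a" "s4 = det3 c d b"
  obtain a1 a2 a3 b1 b2 b3 c1 c2 c3 d1 d2 d3 where
    abcd: "a = (a1, a2, a3)" "b = (b1, b2, b3)" "c = (c1, c2, c3)" "d = (d1, d2, d3)"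
    by (cases a, cases b, cases c, cases d) auto
  have e: "p * a1 + q * b1 = r * c1 + s * d1" "p * a2 + q * b2 = r * c2 + s * d2" "p * a3 + q * b3 = r * c3 + s * d3"
    using eq by (simp_all add: abcd)
  \<comment> \<open>Determinants of the equation with a and b, with c and d, with a and c, with b
    and d. Each is a relation between two nonnegative coefficients, and if its two determinants have
    the same sign, both coefficients vanish.\<close>
  have rel: "r * s1 + s * s2 = 0" "p * s3 + q * s4 = 0" "q * s1 + s * s3 = 0" "p * s2 + r * s4 = 0"
    unfolding s abcd det3.simps using e by algebra+
  have zero: "x = 0 \<and> y = 0" if "x * u + y * v = 0" "0 < u * v" "0 \<le> x" "0 \<le> y" for x y u v :: real
  proof -
    have "(x * u + y * v) * u = 0" using that(1) by simp
    then have "x * u\<^sup>2 + y * (u * v) = 0" by (simp add: algebra_simps power2_eq_square)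
    moreover have "0 \<le> x * u\<^sup>2" "0 \<le> y * (u * v)" using that by simp_all
    ultimately have "x * u\<^sup>2 = 0" "y * (u * v) = 0" by linarith+
    then show ?thesis using that(2) by auto
  qed
  \<comment> \<open>Cramer's rule for the other coefficients: once one relation has removed two of
    them, the nonzero determinants at hand, partly through the remaining relations, remove the
    rest.\<close>
  have third: "p * s1 = s * det3 d b c" "q * s1 = s * det3 a d c" "p * s2 = r * det3 c b d" "q * s2 = r * det3 a c d"
    "r * s3 = q * det3 b d a + p * det3 a d a" "s * s3 = q * det3 c b a + p * det3 c a a"
    unfolding s abcd det3.simps using e by algebra+
  have "s1 * s2 > 0 \<or> s3 * s4 > 0 \<or> s1 * s3 > 0 \<or> s2 * s4 > 0"
    using apart by (simp add: Let_def s)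
  then show ?thesis
  proof (elim disjE)
    assume "s1 * s2 > 0"
    with zero[OF rel(1)] nonneg third(1,2) show ?thesis by auto
  next
    assume "s3 * s4 > 0"
    with zero[OF rel(2)] nonneg third(5,6) show ?thesis by auto
  next
    assume "s1 * s3 > 0"
    with zero[OF rel(3)] nonneg third(1,6) rel show ?thesis by (auto simp: zero_less_mult_iff)
  next
    assume "s2 * s4 > 0"
    with zero[OF rel(4)] nonneg third(4) rel show ?thesis by (auto simp: zero_less_mult_iff)
  qed
qed

text \<open>Two triangles at v are given by the edges opposite to v, and D holds the directions from
  v. An edge compared with itself tests that the triangle is not degenerate. With one common end the
  three directions must be independent, so that the cones share only the common ray. Disjoint edges
  must give cones that share only the apex.\<close>

fun edges_apart :: "(nat \<Rightarrow> 'a :: linordered_idom \<times> 'a \<times> 'a) \<Rightarrow> nat list \<Rightarrow> nat list \<Rightarrow> bool" where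
  "edges_apart D [a, b] [c, d] \<longleftrightarrow>
     (if a = c then (if b = d then independent2 (D a) (D b) else det3 (D a) (D b) (D d) \<noteq> 0)
      else if a = d then (if b = c then independent2 (D a) (D b) else det3 (D a) (D b) (D c) \<noteq> 0)
      else if b = c then det3 (D b) (D a) (D d) \<noteq> 0
      else if b = d then det3 (D b) (D a) (D c) \<noteq> 0
      else cones_apart (D a) (D b) (D c) (D d))"
| "edges_apart D _ _ \<longleftrightarrow> False"

lemma lincomb2_commute: "lincomb2 p a q b = lincomb2 q b p a"
  by (cases a; cases b) (simp add: add.commute)

lemma edges_apart_coeffs:
  fixes D :: "nat \<Rightarrow> real \<times> real \<times> real"
  assumes "edges_apart D [a, b] [c, d]" and eq: "lincomb2 (y a) (D a) (y b) (D b) = lincomb2 (z c) (D c) (z d) (D d)"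
    and nonneg: "\<And>u. 0 \<le> y u" "\<And>u. 0 \<le> z u" and "a \<noteq> b" "c \<noteq> d"
    and supp: "\<And>u. u \<noteq> v \<Longrightarrow> u \<noteq> a \<Longrightarrow> u \<noteq> b \<Longrightarrow> y u = 0" "\<And>u. u \<noteq> v \<Longrightarrow> u \<noteq> c \<Longrightarrow> u \<noteq> d \<Longrightarrow> z u = 0"
    and v: "v \<notin> {a, b, c, d}" and u: "u \<noteq> v"
  shows "y u = z u"
proof -
  have ind: "y e = z e \<and> y f = z f"
    if "independent2 (D e) (D f)" "lincomb2 (y e) (D e) (y f) (D f) = lincomb2 (z e) (D e) (z f) (D f)" for e f
    using independent2_coeffs[OF that] by simp
  have det: "y e = z e \<and> y f = 0 \<and> z g = 0"
    if "det3 (D e) (D f) (D g) \<noteq> 0" "lincomb2 (y e) (D e) (y f) (D f) = lincomb2 (z e) (D e) (z g) (D g)" for e f g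
    using det3_coeffs[OF that] by simp
  consider "a = c" "b = d" | "a = c" "b \<noteq> d" | "a = d" "b = c" | "a = d" "b \<noteq> c" | "b = c" "a \<noteq> d" "a \<noteq> c"
    | "b = d" "a \<noteq> c" "a \<noteq> d" "b \<noteq> c" | "a \<noteq> c" "a \<noteq> d" "b \<noteq> c" "b \<noteq> d"
    by blast
  then show ?thesis
  proof cases
    case 1
    have "y a = z a \<and> y b = z b"
      by (rule ind) (use assms(1) eq 1 in simp_all)
    then show ?thesis using supp[OF u] 1 by metis
  next
    case 2
    have "y a = z a \<and> y b = 0 \<and> z d = 0"
      by (rule det) (use assms(1) eq 2 in simp_all)
    then show ?thesis using supp[OF u] 2 \<open>a \<noteq> b\<close> \<open>c \<noteq> d\<close> by metis
  next
    case 3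
    have "y a = z a \<and> y b = z b"
      by (rule ind) (use assms(1,5) eq 3 lincomb2_commute[of "z c"] in simp_all)
    then show ?thesis using supp[OF u] 3 by metis
  next
    case 4
    have "y a = z a \<and> y b = 0 \<and> z c = 0"
      by (rule det) (use assms(1,5) eq 4 \<open>c \<noteq> d\<close> lincomb2_commute[of "z c"] in simp_all)
    then show ?thesis using supp[OF u] 4 \<open>a \<noteq> b\<close> \<open>c \<noteq> d\<close> by metis
  next
    case 5
    have "y b = z b \<and> y a = 0 \<and> z d = 0"
      by (rule det) (use assms(1,5) eq 5 lincomb2_commute[of "y a"] in simp_all)
    then show ?thesis using supp[OF u] 5 \<open>a \<noteq> b\<close> \<open>c \<noteq> d\<close> by metis
  next
    case 6
    have "y b = z b \<and> y a = 0 \<and> z c = 0"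
      by (rule det) (use assms(1,5) eq 6 lincomb2_commute[of "y a"] lincomb2_commute[of "z c"] in simp_all)
    then show ?thesis using supp[OF u] 6 \<open>a \<noteq> b\<close> \<open>c \<noteq> d\<close> by metis
  next
    case 7
    then have "cones_apart (D a) (D b) (D c) (D d)" using assms(1) by simp
    from cones_apart_coeffs[OF this eq nonneg(1,1,2,2)]
    show ?thesis using supp[OF u] by metis
  qed
qed

text \<open>The diagonal belongs to the test, since it rules out degenerate triangles. Every other
  pair is tested in one order only, whence the disjunction in \<open>all_pairsD\<close>.\<close>

fun all_pairs :: "('a \<Rightarrow> 'a \<Rightarrow> bool) \<Rightarrow> 'a list \<Rightarrow> bool" where
  "all_pairs R [] \<longleftrightarrow> True"
| "all_pairs R (x # xs) \<longleftrightarrow> R x x \<and> (\<forall>y\<in>set xs. R x y) \<and> all_pairs R xs"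

lemma all_pairsD: "all_pairs R xs \<Longrightarrow> x \<in> set xs \<Longrightarrow> y \<in> set xs \<Longrightarrow> R x y \<or> R y x"
  by (induction xs) auto

fun minus3 :: "int \<times> int \<times> int \<Rightarrow> int \<times> int \<times> int \<Rightarrow> int \<times> int \<times> int" where
  "minus3 (a1, a2, a3) (b1, b2, b3) = (a1 - b1, a2 - b2, a3 - b3)"

fun of_int3 :: "int \<times> int \<times> int \<Rightarrow> real \<times> real \<times> real" where
  "of_int3 (a1, a2, a3) = (of_int a1, of_int a2, of_int a3)"

fun vec_of :: "real \<times> real \<times> real \<Rightarrow> real^3" where
  "vec_of (a1, a2, a3) = vector [a1, a2, a3]"

definition point :: "int \<times> int \<times> int \<Rightarrow> real^3" where
  "point a = vec_of (of_int3 a)"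

lemma vec_of_inject: "vec_of a = vec_of b \<longleftrightarrow> a = b"
  by (cases a; cases b) (simp add: vec_eq_iff forall_3)

lemma vec_of_lincomb2: "p *\<^sub>R vec_of a + q *\<^sub>R vec_of b = vec_of (lincomb2 p a q b)"
  by (cases a; cases b) (simp add: vec_eq_iff forall_3)

lemma point_diff: "point a - point b = vec_of (of_int3 (minus3 a b))"
  by (cases a; cases b) (simp add: point_def vec_eq_iff forall_3)

definition link :: "nat \<Rightarrow> nat list list \<Rightarrow> nat list list" where
  "link v ts = map (remove1 v) (filter (\<lambda>t. v \<in> set t) ts)"

definition immersed :: "nat list list \<Rightarrow> (nat \<Rightarrow> int \<times> int \<times> int) \<Rightarrow> bool" where
  "immersed ts P \<longleftrightarrow> (\<forall>v\<in>set (remdups (concat ts)). all_pairs (edges_apart (\<lambda>u. minus3 (P u) (P v))) (link v ts))"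

lemma det3_of_int3: "det3 (of_int3 a) (of_int3 b) (of_int3 c) = of_int (det3 a b c)"
  by (cases a; cases b; cases c) simp

lemma independent2_of_int3: "independent2 (of_int3 a) (of_int3 b) \<longleftrightarrow> independent2 a b"
  by (cases a; cases b) (simp flip: of_int_mult of_int_diff)

lemma cones_apart_of_int3: "cones_apart (of_int3 a) (of_int3 b) (of_int3 c) (of_int3 d) \<longleftrightarrow> cones_apart a b c d"
  unfolding cones_apart.simps det3_of_int3 Let_def of_int_mult[symmetric] of_int_0_less_iff ..

lemma edges_apart_of_int3: "edges_apart (\<lambda>u. of_int3 (D u)) [a, b] [c, d] \<longleftrightarrow> edges_apart D [a, b] [c, d]"
  by (simp only: edges_apart.simps det3_of_int3 independent2_of_int3 cones_apart_of_int3 of_int_eq_0_iff)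

lemma link_edge:
  assumes "is_triangle t" "v \<in> set t"
  obtains a b where "remove1 v t = [a, b]" "a \<noteq> b" "v \<noteq> a" "v \<noteq> b" "set t = {v, a, b}"
proof -
  have "length (remove1 v t) = 2" "distinct (remove1 v t)" "set (remove1 v t) = set t - {v}"
    using assms by (auto simp: is_triangle_def length_remove1 set_remove1_eq)
  then obtain a b where *: "remove1 v t = [a, b]" "distinct [a, b]" "{a, b} = set t - {v}"
    by (auto simp: length_Suc_conv numeral_2_eq_2)
  then show thesis
    using assms(2) by (intro that[of a b]) auto
qed

text \<open>On the open star of v the coordinate of v can be eliminated. The image is then the apex
  plus a nonnegative combination of two edge directions, which turns injectivity into a statement
  about cones.\<close>

lemma simplexwise_linear_triangle:
  assumes ts: "\<forall>t\<in>set ts. is_triangle t" and y: "y \<in> underlying_space (spanned ts)" "0 < y v"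
  obtains a b where "[a, b] \<in> set (link v ts)" "a \<noteq> b" "v \<noteq> a" "v \<noteq> b"
    "\<forall>u. u \<noteq> v \<longrightarrow> u \<noteq> a \<longrightarrow> u \<noteq> b \<longrightarrow> y u = 0" "y v = 1 - y a - y b"
    "\<forall>\<psi>. simplexwise_linear (spanned ts) \<psi> y = \<psi> v + y a *\<^sub>R (\<psi> a - \<psi> v) + y b *\<^sub>R (\<psi> b - \<psi> v)"
proof -
  note y' = underlying_spaceD[OF abstract_spanned y(1)]
  obtain t where t: "t \<in> set ts" "{u. y u \<noteq> 0} \<subseteq> set t"
    using y'(2) by (rule spannedE)
  have "v \<in> set t" using t(2) y(2) by auto
  obtain a b where ab: "remove1 v t = [a, b]" "a \<noteq> b" "v \<noteq> a" "v \<noteq> b" "set t = {v, a, b}"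
    using link_edge[OF _ \<open>v \<in> set t\<close>] ts t(1) by blast
  have "sum y (set t) = 1"
    using underlying_space_iff[OF abstract_spanned _ t(2)] y(1) by simp
  then have yv: "y v = 1 - y a - y b"
    using ab by (simp add: ab(5))
  show thesis
  proof (rule that[of a b])
    show "[a, b] \<in> set (link v ts)"
      using t(1) \<open>v \<in> set t\<close> ab(1) by (auto simp: link_def image_iff intro!: bexI[of _ t])
    show "\<forall>u. u \<noteq> v \<longrightarrow> u \<noteq> a \<longrightarrow> u \<noteq> b \<longrightarrow> y u = 0"
      using t(2) ab(5) by auto
    show "\<forall>\<psi>. simplexwise_linear (spanned ts) \<psi> y = \<psi> v + y a *\<^sub>R (\<psi> a - \<psi> v) + y b *\<^sub>R (\<psi> b - \<psi> v)"
    proof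
      fix \<psi> :: "nat \<Rightarrow> real^3"
      have "simplexwise_linear (spanned ts) \<psi> y = (\<Sum>u\<in>set t. y u *\<^sub>R \<psi> u)"
        unfolding simplexwise_linear_def vertices_spanned
        using t by (intro sum.mono_neutral_right) auto
      also have "\<dots> = \<psi> v + y a *\<^sub>R (\<psi> a - \<psi> v) + y b *\<^sub>R (\<psi> b - \<psi> v)"
        using ab by (simp add: ab(5) yv algebra_simps)
      finally show "simplexwise_linear (spanned ts) \<psi> y = \<psi> v + y a *\<^sub>R (\<psi> a - \<psi> v) + y b *\<^sub>R (\<psi> b - \<psi> v)" .
    qed
  qed (use ab yv in auto)
qed

lemma polyhedral_realization_immersed:
  assumes ts: "\<forall>t\<in>set ts. is_triangle t" and im: "immersed ts P"
  shows "polyhedral_realization (spanned ts) (\<lambda>v. point (P v))"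
  unfolding polyhedral_realization_def locally_injective_on_def
proof
  let ?\<phi> = "simplexwise_linear (spanned ts) (\<lambda>v. point (P v))"
  fix x assume x: "x \<in> underlying_space (spanned ts)"
  note x' = underlying_spaceD[OF abstract_spanned x]
  obtain v where v: "x v \<noteq> 0" "v \<in> vertices (spanned ts)"
    using abstract_complexD(4)[OF abstract_spanned x'(2)] abstract_complexD(6)[OF abstract_spanned x'(2)] by blast
  define D where "D = (\<lambda>u. of_int3 (minus3 (P u) (P v)))"
  have ap: "all_pairs (edges_apart (\<lambda>u. minus3 (P u) (P v))) (link v ts)"
    by (rule bspec[OF im[unfolded immersed_def]]) (use v(2) in \<open>simp only: vertices_spanned set_remdups\<close>)
  have apart: "edges_apart D [a, b] [c, d] \<or> edges_apart D [c, d] [a, b]"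
    if "[a, b] \<in> set (link v ts)" "[c, d] \<in> set (link v ts)" for a b c d
    using all_pairsD[OF ap that] unfolding D_def edges_apart_of_int3 .
  have *: "lincomb2 p (D a) q (D b) = lincomb2 r (D c) s (D d)"
    if "p *\<^sub>R (point (P a) - point (P v)) + q *\<^sub>R (point (P b) - point (P v)) =
      r *\<^sub>R (point (P c) - point (P v)) + s *\<^sub>R (point (P d) - point (P v))" for p q r s a b c d
    using that by (simp only: point_diff vec_of_lincomb2 vec_of_inject D_def)
  have "inj_on ?\<phi> ({y. 0 < y v} \<inter> underlying_space (spanned ts))"
  proof (rule inj_onI)
    fix y z assume y: "y \<in> {y. 0 < y v} \<inter> underlying_space (spanned ts)"
      and z: "z \<in> {y. 0 < y v} \<inter> underlying_space (spanned ts)" and eq: "?\<phi> y = ?\<phi> z"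
    have y': "y \<in> underlying_space (spanned ts)" "0 < y v" using y by simp_all
    have z': "z \<in> underlying_space (spanned ts)" "0 < z v" using z by simp_all
    obtain a b where ab: "[a, b] \<in> set (link v ts)" "a \<noteq> b" "v \<noteq> a" "v \<noteq> b"
      "\<forall>u. u \<noteq> v \<longrightarrow> u \<noteq> a \<longrightarrow> u \<noteq> b \<longrightarrow> y u = 0" "y v = 1 - y a - y b"
      "\<forall>\<psi>. simplexwise_linear (spanned ts) \<psi> y = \<psi> v + y a *\<^sub>R (\<psi> a - \<psi> v) + y b *\<^sub>R (\<psi> b - \<psi> v)"
      by (rule simplexwise_linear_triangle[OF ts y'])
    obtain c d where cd: "[c, d] \<in> set (link v ts)" "c \<noteq> d" "v \<noteq> c" "v \<noteq> d"
      "\<forall>u. u \<noteq> v \<longrightarrow> u \<noteq> c \<longrightarrow> u \<noteq> d \<longrightarrow> z u = 0" "z v = 1 - z c - z d"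
      "\<forall>\<psi>. simplexwise_linear (spanned ts) \<psi> z = \<psi> v + z c *\<^sub>R (\<psi> c - \<psi> v) + z d *\<^sub>R (\<psi> d - \<psi> v)"
      by (rule simplexwise_linear_triangle[OF ts z'])
    have nonneg: "0 \<le> y u" "0 \<le> z u" for u
      using y z underlying_spaceD(1)[OF abstract_spanned] by auto
    have lin: "lincomb2 (y a) (D a) (y b) (D b) = lincomb2 (z c) (D c) (z d) (D d)"
      by (rule *) (use eq in \<open>simp add: ab(7)[rule_format] cd(7)[rule_format] add.assoc\<close>)
    have off: "y u = z u" if "u \<noteq> v" for u
      using apart[OF ab(1) cd(1)]
    proof
      assume "edges_apart D [a, b] [c, d]"
      from edges_apart_coeffs[OF this lin nonneg ab(2) cd(2) ab(5)[rule_format] cd(5)[rule_format] _ that]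
      show ?thesis using ab cd by auto
    next
      assume "edges_apart D [c, d] [a, b]"
      from edges_apart_coeffs[OF this lin[symmetric] nonneg(2,1) cd(2) ab(2) cd(5)[rule_format] ab(5)[rule_format] _ that]
      show ?thesis using ab cd by auto
    qed
    \<comment> \<open>The coordinate at v is the remaining one, determined by the total 1.\<close>
    have "sum y (set (concat ts)) = 1" "sum z (set (concat ts)) = 1"
      using y z by (auto simp: underlying_space_def vertices_spanned)
    moreover have "v \<in> set (concat ts)" using v(2) by (simp add: vertices_spanned)
    ultimately have "y v + sum y (set (concat ts) - {v}) = z v + sum z (set (concat ts) - {v})"
      by (simp add: sum.remove[symmetric])
    moreover have "sum y (set (concat ts) - {v}) = sum z (set (concat ts) - {v})"
      by (rule sum.cong) (use off in auto)
    ultimately have "y v = z v" by simp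
    with off show "y = z" by (metis ext)
  qed
  moreover have "open {y :: nat \<Rightarrow> real. 0 < y v}"
    by (intro open_Collect_less continuous_on_coordinate continuous_intros)
  moreover have "0 < x v" using v(1) x'(1)[of v] by simp
  ultimately show "\<exists>U. open U \<and> x \<in> U \<and> inj_on ?\<phi> (U \<inter> underlying_space (spanned ts))"
    by blast
qed

section \<open>Threefold symmetry\<close>

fun cycle3 :: "int \<times> int \<times> int \<Rightarrow> int \<times> int \<times> int" where
  "cycle3 (a1, a2, a3) = (a3, a1, a2)"

text \<open>The condition that \<alpha> has order dividing three on the vertices provides the
  inverse \<open>\<alpha> \<circ> \<alpha>\<close>; hence mapping triangles to triangles already
  yields an automorphism.\<close>

definition symmetric :: "nat list list \<Rightarrow> (nat \<Rightarrow> int \<times> int \<times> int) \<Rightarrow> (nat \<Rightarrow> nat) \<Rightarrow> bool" where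
  "symmetric ts P \<alpha> \<longleftrightarrow> (\<forall>t\<in>set ts. sort (map \<alpha> t) \<in> set ts) \<and>
     (\<forall>v\<in>set (remdups (concat ts)). P (\<alpha> v) = cycle3 (P v) \<and> \<alpha> (\<alpha> (\<alpha> v)) = v) \<and>
     (\<exists>v\<in>set (remdups (concat ts)). \<alpha> v \<noteq> v)"

definition turn :: "real^3 \<Rightarrow> real^3" where
  "turn x = vector [x$3, x$1, x$2]"

text \<open>The matrix of a 3-cycle of the unit vectors is orthogonal, has determinant 1 as the
  permutation is even, and fixes the diagonal.\<close>

lemma rotation_turn: "rotation_about_line 0 (vector [1, 1, 1]) turn"
proof -
  define A :: "real^3^3" where "A = vector [vector [0, 0, 1], vector [1, 0, 0], vector [0, 1, 0]]"
  have A: "A *v x = turn x" for x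
    by (simp add: A_def turn_def vec_eq_iff forall_3 matrix_vector_mult_def sum_3)
  have "orthogonal_matrix A"
    by (simp add: A_def orthogonal_matrix_def vec_eq_iff forall_3 matrix_matrix_mult_def transpose_def mat_def sum_3)
  moreover have "det A = 1"
    by (simp add: A_def det_3)
  moreover have "turn (vector [1, 1, 1]) = vector [1, 1, 1]"
    by (simp add: turn_def)
  moreover have "(vector [1, 1, 1] :: real^3) \<noteq> 0"
    by (simp add: vec_eq_iff forall_3)
  ultimately show ?thesis
    unfolding rotation_about_line_def rotation_matrix_def by (intro conjI exI[of _ A]) (simp_all add: A)
qed

lemma dist_turn: "dist (turn x) (turn y) = dist x y"
  by (simp add: turn_def dist_vec_def L2_set_def sum_3 algebra_simps)

lemma turn_turn_turn: "turn (turn (turn x)) = x"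
  by (simp add: turn_def vec_eq_iff forall_3)

lemma turn_linear: "turn (\<Sum>v\<in>S. f v *\<^sub>R \<psi> v) = (\<Sum>v\<in>S. f v *\<^sub>R turn (\<psi> v))"
  by (simp add: turn_def vec_eq_iff forall_3)

lemma turn_point: "turn (point a) = point (cycle3 a)"
  by (cases a) (simp add: turn_def point_def vec_eq_iff forall_3)

lemma symmetricD:
  assumes "symmetric ts P \<alpha>"
  shows "v \<in> vertices (spanned ts) \<Longrightarrow> P (\<alpha> v) = cycle3 (P v)"
    and "v \<in> vertices (spanned ts) \<Longrightarrow> \<alpha> (\<alpha> (\<alpha> v)) = v"
    and "v \<in> vertices (spanned ts) \<Longrightarrow> \<alpha> v \<in> vertices (spanned ts)"
    and "\<sigma> \<in> spanned ts \<Longrightarrow> \<alpha> ` \<sigma> \<in> spanned ts"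
proof -
  have *: "\<alpha> ` set t \<in> set ` set ts" if "t \<in> set ts" for t
    using assms that unfolding symmetric_def by (auto intro!: image_eqI[of _ set "sort (map \<alpha> t)"])
  show "v \<in> vertices (spanned ts) \<Longrightarrow> P (\<alpha> v) = cycle3 (P v)"
    "v \<in> vertices (spanned ts) \<Longrightarrow> \<alpha> (\<alpha> (\<alpha> v)) = v"
    using assms by (auto simp: symmetric_def vertices_spanned)
  have **: "\<alpha> ` \<sigma> \<in> spanned ts" if "\<sigma> \<in> spanned ts" for \<sigma>
  proof -
    obtain t where t: "t \<in> set ts" "\<sigma> \<subseteq> set t"
      using \<open>\<sigma> \<in> spanned ts\<close> by (rule spannedE)
    have "\<alpha> ` \<sigma> \<noteq> {}"
      using abstract_complexD(4)[OF abstract_spanned \<open>\<sigma> \<in> spanned ts\<close>] by simp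
    then    show ?thesis
      unfolding spanned_def by (rule complex_ofI[OF _ *[OF t(1)]]) (use t in auto)
  qed
  then show "\<sigma> \<in> spanned ts \<Longrightarrow> \<alpha> ` \<sigma> \<in> spanned ts" .
  show "\<alpha> v \<in> vertices (spanned ts)" if v: "v \<in> vertices (spanned ts)"
  proof -
    obtain \<sigma> where "\<sigma> \<in> spanned ts" "v \<in> \<sigma>" using v by (auto simp: vertices_def)
    then show ?thesis using **[of \<sigma>] by (auto simp: vertices_def)
  qed
qed

lemma simplicial_iso_symmetric:
  assumes "symmetric ts P \<alpha>"
  shows "simplicial_iso \<alpha> (spanned ts) (spanned ts)"
proof -
  note sym = symmetricD[OF assms]
  have "bij_betw \<alpha> (vertices (spanned ts)) (vertices (spanned ts))"
    by (rule bij_betw_byWitness[where f' = "\<lambda>v. \<alpha> (\<alpha> v)"]) (use sym(2,3) in auto)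
  moreover have "\<sigma> \<in> (`) \<alpha> ` spanned ts" if \<sigma>: "\<sigma> \<in> spanned ts" for \<sigma>
  proof (rule image_eqI)
    show "\<alpha> ` \<alpha> ` \<sigma> \<in> spanned ts" using sym(4) \<sigma> by blast
    have "\<sigma> \<subseteq> vertices (spanned ts)" using \<sigma> by (auto simp: vertices_def)
    then show "\<sigma> = \<alpha> ` \<alpha> ` \<alpha> ` \<sigma>" using sym(2) by (force simp: image_image)
  qed
  ultimately show ?thesis
    unfolding simplicial_iso_def using sym(4) by blast
qed

lemma induced_map_in_underlying_space:
  assumes iso: "simplicial_iso \<alpha> K K" and K: "abstract_complex K" and x: "x \<in> underlying_space K"
  shows "induced_map K \<alpha> x \<in> underlying_space K"
proof -
  note x' = underlying_spaceD[OF K x]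
  have bij: "bij_betw \<alpha> (vertices K) (vertices K)" and im: "(`) \<alpha> ` K = K"
    using iso by (auto simp: simplicial_iso_def)
  have fin: "finite (vertices K)" using abstract_complexD(2)[OF K] .
  have inj: "inj_on \<alpha> (vertices K)" using bij by (simp add: bij_betw_def)
  have val: "induced_map K \<alpha> x (\<alpha> v) = x v" if "v \<in> vertices K" for v
  proof -
    have "{u \<in> vertices K. \<alpha> u = \<alpha> v} = {v}" using that inj by (auto simp: inj_on_def)
    then show ?thesis by (simp add: induced_map_def)
  qed
  have off: "induced_map K \<alpha> x w = 0" if "w \<notin> vertices K" for w
  proof -
    have "{u \<in> vertices K. \<alpha> u = w} = {}" using that bij by (auto simp: bij_betw_def)
    then show ?thesis by (simp only: induced_map_def sum.empty)
  qed
  have sV: "{v. x v \<noteq> 0} \<subseteq> vertices K" using x'(2) by (auto simp: vertices_def)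
  have "{w. induced_map K \<alpha> x w \<noteq> 0} = \<alpha> ` {v. x v \<noteq> 0}"
  proof (intro set_eqI iffI)
    fix w assume w: "w \<in> {w. induced_map K \<alpha> x w \<noteq> 0}"
    then have "w \<in> vertices K" using off by auto
    then obtain v where v: "v \<in> vertices K" "w = \<alpha> v" using bij by (auto simp: bij_betw_def)
    then show "w \<in> \<alpha> ` {v. x v \<noteq> 0}" using w val by auto
  qed (use val sV in auto)
  then have "{w. induced_map K \<alpha> x w \<noteq> 0} \<in> K"
    using x'(2) im by auto
  moreover have "0 \<le> induced_map K \<alpha> x w" for w
    unfolding induced_map_def using x'(1) by (auto intro: sum_nonneg)
  moreover have "(\<Sum>w\<in>vertices K. induced_map K \<alpha> x w) = (\<Sum>v\<in>vertices K. x v)"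
    using sum.reindex_bij_betw[OF bij, of "induced_map K \<alpha> x"] val by simp
  ultimately show ?thesis
    using x by (simp add: underlying_space_def)
qed

lemma simplexwise_linear_induced_map:
  assumes "simplicial_iso \<alpha> K K" "abstract_complex K"
  shows "simplexwise_linear K \<psi> (induced_map K \<alpha> x) = (\<Sum>v\<in>vertices K. x v *\<^sub>R \<psi> (\<alpha> v))"
proof -
  have bij: "bij_betw \<alpha> (vertices K) (vertices K)"
    using assms(1) by (simp add: simplicial_iso_def)
  have "induced_map K \<alpha> x (\<alpha> v) = x v" if "v \<in> vertices K" for v
  proof -
    have "{u \<in> vertices K. \<alpha> u = \<alpha> v} = {v}" using that bij by (auto simp: bij_betw_def inj_on_def)
    then show ?thesis by (simp add: induced_map_def)
  qed
  then show ?thesis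
    unfolding simplexwise_linear_def
    using sum.reindex_bij_betw[OF bij, of "\<lambda>w. induced_map K \<alpha> x w *\<^sub>R \<psi> w"] by simp
qed

lemma threefold_rotational_symmetry_symmetric:
  assumes "symmetric ts P \<alpha>"
  shows "threefold_rotational_symmetry (spanned ts) (\<lambda>v. point (P v))"
proof -
  let ?K = "spanned ts" and ?\<psi> = "\<lambda>v. point (P v)"
  let ?\<phi> = "simplexwise_linear ?K ?\<psi>"
  note sym = symmetricD[OF assms] and iso = simplicial_iso_symmetric[OF assms]
  have equi: "turn (?\<phi> x) = ?\<phi> (induced_map ?K \<alpha> x)" for x
    unfolding simplexwise_linear_induced_map[OF iso abstract_spanned]
    by (simp add: simplexwise_linear_def turn_linear turn_point sym(1))
  have into: "turn y \<in> ?\<phi> ` underlying_space ?K" if "y \<in> ?\<phi> ` underlying_space ?K" for y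
    using that equi induced_map_in_underlying_space[OF iso abstract_spanned] by auto
  have "turn ` ?\<phi> ` underlying_space ?K = ?\<phi> ` underlying_space ?K"
  proof
    show "turn ` ?\<phi> ` underlying_space ?K \<subseteq> ?\<phi> ` underlying_space ?K"
      using into by blast
    show "?\<phi> ` underlying_space ?K \<subseteq> turn ` ?\<phi> ` underlying_space ?K"
    proof
      fix y assume "y \<in> ?\<phi> ` underlying_space ?K"
      \<comment> \<open>The third power of \<open>turn\<close> is the identity, so this point is the
        preimage of y.\<close>
      then have "turn (turn y) \<in> ?\<phi> ` underlying_space ?K" using into by blast
      then show "y \<in> turn ` ?\<phi> ` underlying_space ?K"
        by (rule image_eqI[rotated]) (simp add: turn_turn_turn)
    qed
  qed
  then have "geometric_symmetry ?K ?\<psi> turn \<alpha>"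
    unfolding geometric_symmetry_def using dist_turn iso equi by blast
  moreover have "turn \<noteq> id"
  proof
    assume "turn = id"
    then have "turn (vector [1, 0, 0]) = vector [1, 0, 0]" by simp
    then show False by (simp add: turn_def vec_eq_iff forall_3)
  qed
  moreover have "turn \<circ> turn \<circ> turn = id"
    by (simp add: fun_eq_iff turn_turn_turn)
  moreover have "\<exists>v\<in>vertices ?K. \<alpha> v \<noteq> v"
    using assms by (auto simp: symmetric_def vertices_spanned)
  ultimately show ?thesis
    unfolding threefold_rotational_symmetry_def using rotation_turn by blast
qed

section \<open>A combinatorial invariant\<close>

definition triangles :: "'v set set \<Rightarrow> 'v set set" where
  "triangles K = {\<sigma> \<in> K. card \<sigma> = 3}"

definition degree :: "'v set set \<Rightarrow> 'v \<Rightarrow> nat" where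
  "degree K v = (\<Sum>\<sigma>\<in>triangles K. if v \<in> \<sigma> then 1 else 0)"

text \<open>
  The degrees of the vertices do not tell the ten surfaces apart, but the degrees of the vertices
  opposite to \<open>v\<close> across the edges of its link do.
\<close>

definition opposite_degree :: "'v set set \<Rightarrow> 'v \<Rightarrow> nat" where
  "opposite_degree K v = (\<Sum>\<sigma>\<in>triangles K. if v \<in> \<sigma> then
     (\<Sum>\<tau>\<in>triangles K. if card (\<sigma> \<inter> \<tau>) = 2 \<and> v \<notin> \<tau> then sum (degree K) (\<tau> - \<sigma>) else 0) else 0)"

text \<open>The squares matter: on a closed surface each triangle at w has one neighbour across the
  edge opposite to w, so the plain sum of the opposite degrees is the sum of the squared degrees and
  sees no more than the degrees do.\<close>

definition invariant :: "'v set set \<Rightarrow> nat" where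
  "invariant K = (\<Sum>v\<in>vertices K. (opposite_degree K v)\<^sup>2)"

lemma invariant_simplicial_iso:
  assumes iso: "simplicial_iso f K L"
  shows "invariant K = invariant L"
proof -
  have bij: "bij_betw f (vertices K) (vertices L)" and im: "(`) f ` K = L"
    using iso by (auto simp: simplicial_iso_def)
  have inj: "inj_on f (vertices K)" using bij by (simp add: bij_betw_def)
  have sub: "\<sigma> \<subseteq> vertices K" if "\<sigma> \<in> K" for \<sigma> using that by (auto simp: vertices_def)
  have card: "card (f ` \<sigma>) = card \<sigma>" if "\<sigma> \<subseteq> vertices K" for \<sigma>
    using card_image inj_on_subset[OF inj that] by blast
  have TK: "\<sigma> \<subseteq> vertices K" if "\<sigma> \<in> triangles K" for \<sigma>
    using that sub by (auto simp: triangles_def)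
  have tri: "triangles L = (`) f ` triangles K"
    using card sub by (auto simp: triangles_def im[symmetric])
  have inj': "inj_on ((`) f) (triangles K)"
    using inj_on_image_eq_iff[OF inj TK TK] by (auto intro: inj_onI)
  have sum_tri: "sum h (triangles L) = (\<Sum>\<sigma>\<in>triangles K. h (f ` \<sigma>))" for h :: "'b set \<Rightarrow> nat"
    unfolding tri by (simp add: sum.reindex[OF inj'])
  have mem: "f v \<in> f ` \<sigma> \<longleftrightarrow> v \<in> \<sigma>" if "\<sigma> \<in> triangles K" "v \<in> vertices K" for \<sigma> v
    using inj_on_image_mem_iff[OF inj that(2) TK[OF that(1)]] .
  have deg: "degree L (f v) = degree K v" if "v \<in> vertices K" for v
    unfolding degree_def sum_tri using that by (intro sum.cong) (simp_all add: mem)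
  have diff: "sum (degree L) (f ` \<tau> - f ` \<sigma>) = sum (degree K) (\<tau> - \<sigma>)"
    if "\<sigma> \<in> triangles K" "\<tau> \<in> triangles K" for \<sigma> \<tau>
  proof -
    have "f ` \<tau> - f ` \<sigma> = f ` (\<tau> - \<sigma>)"
      using inj_on_image_set_diff[OF inj, of \<tau> \<sigma>] TK that by blast
    moreover have "inj_on f (\<tau> - \<sigma>)" using inj TK that by (meson Diff_subset inj_on_subset order_trans)
    moreover have "(\<Sum>v\<in>\<tau> - \<sigma>. degree L (f v)) = sum (degree K) (\<tau> - \<sigma>)"
      using TK[OF that(2)] by (intro sum.cong) (auto simp: deg)
    ultimately show ?thesis by (simp add: sum.reindex)
  qed
  have inter: "card (f ` \<sigma> \<inter> f ` \<tau>) = card (\<sigma> \<inter> \<tau>)" if "\<sigma> \<in> triangles K" "\<tau> \<in> triangles K" for \<sigma> \<tau>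
  proof -
    have "f ` \<sigma> \<inter> f ` \<tau> = f ` (\<sigma> \<inter> \<tau>)"
      using inj_on_image_Int[OF inj] TK that by blast
    then show ?thesis using card[of "\<sigma> \<inter> \<tau>"] TK[OF that(1)] by auto
  qed
  have opp: "opposite_degree L (f v) = opposite_degree K v" if v: "v \<in> vertices K" for v
    unfolding opposite_degree_def sum_tri
    by (intro sum.cong refl if_cong) (simp_all add: mem[OF _ v] inter diff)
  show ?thesis
    unfolding invariant_def using sum.reindex_bij_betw[OF bij, of "\<lambda>w. (opposite_degree L w)\<^sup>2"]
    by (simp add: opp)
qed

section \<open>Evaluation of the invariant on lists\<close>

definition degree_list :: "nat list list \<Rightarrow> nat \<Rightarrow> nat" where
  "degree_list ts v = sum_list (map (\<lambda>t. if v \<in> set t then 1 else 0) ts)"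

definition opposite_degree_list :: "nat list list \<Rightarrow> nat \<Rightarrow> nat" where
  "opposite_degree_list ts v = sum_list (map (\<lambda>s. if v \<in> set s then
     sum_list (map (\<lambda>t. if length (filter (\<lambda>x. x \<in> set t) s) = 2 \<and> v \<notin> set t
       then sum_list (map (degree_list ts) (filter (\<lambda>x. x \<notin> set s) t)) else 0) ts) else 0) ts)"

definition invariant_list :: "nat list list \<Rightarrow> nat" where
  "invariant_list ts = sum_list (map (\<lambda>v. (opposite_degree_list ts v)\<^sup>2) (remdups (concat ts)))"

lemma invariant_spanned:
  assumes ts: "\<forall>t\<in>set ts. is_triangle t" and "distinct ts"
  shows "invariant (spanned ts) = invariant_list ts"
proof -
  have inj: "inj_on set (set ts)"
    using ts is_triangle_set_eq by (auto intro!: inj_onI)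
  have sum_tri: "sum h (triangles (spanned ts)) = sum_list (map (\<lambda>t. h (set t)) ts)" for h :: "nat set \<Rightarrow> nat"
    unfolding triangles_def triangles_spanned[OF ts]
    using \<open>distinct ts\<close> by (simp add: sum.reindex[OF inj] sum.distinct_set_conv_list)
  have dist: "distinct t" if "t \<in> set ts" for t
    using that ts by (simp add: is_triangle_def)
  have deg: "degree (spanned ts) = degree_list ts"
    unfolding degree_def degree_list_def sum_tri ..
  have diff: "sum (degree_list ts) (set t - set s) = sum_list (map (degree_list ts) (filter (\<lambda>x. x \<notin> set s) t))"
    if "t \<in> set ts" for s t
  proof -
    have "set t - set s = set (filter (\<lambda>x. x \<notin> set s) t)" by auto
    then show ?thesis using dist[OF that] by (simp only: sum.distinct_set_conv_list distinct_filter)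
  qed
  have inter: "card (set s \<inter> set t) = length (filter (\<lambda>x. x \<in> set t) s)" if "s \<in> set ts" for s t
  proof -
    have "set s \<inter> set t = set (filter (\<lambda>x. x \<in> set t) s)" by auto
    then show ?thesis using dist[OF that] by (simp only: distinct_card distinct_filter)
  qed
  have "opposite_degree (spanned ts) = opposite_degree_list ts"
    unfolding opposite_degree_def opposite_degree_list_def sum_tri deg
    by (intro ext arg_cong[of _ _ sum_list] map_cong refl if_cong) (simp_all add: inter diff)
  then show ?thesis
    unfolding invariant_def invariant_list_def vertices_spanned
    by (simp add: sum.distinct_set_conv_list[symmetric])
qed

section \<open>Ten immersed surfaces\<close>

definition hemi_octahedron_list :: "nat list list" where
  "hemi_octahedron_list =
     [[0, 3, 5], [1, 3, 7], [2, 5, 7], [3, 5, 7], [0, 3, 6], [1, 3, 8], [2, 6, 8], [3, 6, 8],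
      [0, 4, 5], [1, 4, 8], [2, 5, 8], [4, 5, 8], [0, 4, 6], [1, 4, 7], [2, 6, 7], [4, 6, 7]]"

text \<open>The six-vertex projective plane, which is the quotient of the icosahedron by the
  antipodal map; all 15 pairs of vertices are edges.\<close>

definition projective_plane_list :: "nat list list" where
  "projective_plane_list =
     [[3, 4, 8], [3, 4, 7], [6, 7, 8], [5, 7, 8], [3, 5, 6], [4, 5, 6], [3, 5, 7], [3, 6, 8],
      [4, 5, 8], [4, 6, 7]]"

text \<open>
  The vertices of \<open>projective_plane_list\<close> are \<open>3, \<dots>, 8\<close>, so the first three entries of each list of
  new labels are padding.
\<close>

definition crosscaps :: "(nat list \<times> nat list \<times> (nat list \<times> nat list) list) list" where
  "crosscaps =
    [([0, 0, 0, 4, 5, 0, 1, 8, 10], [4, 5, 8],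
      [([5, 8], [1, 7]), ([0, 10], [5, 8]), ([1, 5], [0, 7]), ([10, 8], [1, 5]), ([10], [1, 4, 5])]),
     ([0, 0, 0, 3, 5, 10, 9, 6, 2], [3, 5, 6],
      [([5, 6], [4, 9]), ([6, 9], [4, 2]), ([10, 3], [6, 9]), ([10, 9], [5, 6]), ([10], [5, 6, 2])]),
     ([0, 0, 0, 4, 5, 10, 11, 9, 12], [4, 5, 9],
      [([4, 5], [1, 12]), ([10, 11], [4, 5]), ([4, 9], [10, 2]), ([5, 11], [4, 9]),
       ([11], [4, 9, 12]), ([4, 12], [1, 9]), ([9, 12], [1, 10]), ([12], [1, 10, 5]),
       ([1, 4], [0, 9]), ([10, 5], [1, 4]), ([10, 9], [1, 2]), ([10], [1, 4, 2])]),
     ([0, 0, 0, 0, 1, 10, 11, 9, 12], [0, 1, 9],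
      [([1, 9], [2, 11]), ([10, 12], [1, 9]), ([0, 1], [7, 12]), ([10, 11], [0, 1]),
       ([10], [0, 1, 9]), ([1, 11], [0, 2]), ([0, 11], [2, 12]), ([11], [9, 2, 12]),
       ([0, 12], [7, 2]), ([1, 12], [7, 9]), ([12], [7, 9, 2])])]"

text \<open>It has 10 vertices, 26 triangles and 39 edges, hence Euler characteristic -3 = 2 - 5.
  Only six of the 45 pairs of vertices are not edges, and an edge flip has to create one of
  these.\<close>

definition N5_list :: "nat list list" where
  "N5_list =
     [[2, 7, 9], [1, 7, 9], [0, 2, 7], [0, 1, 2], [0, 1, 9], [1, 2, 4], [1, 4, 5], [0, 4, 9],
      [4, 5, 9], [2, 5, 6], [5, 6, 9], [3, 6, 9], [2, 4, 6], [1, 5, 8], [0, 5, 7], [0, 5, 8],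
      [1, 7, 8], [3, 4, 8], [3, 4, 7], [6, 7, 8], [3, 5, 7], [3, 6, 8], [4, 6, 7], [0, 4, 8],
      [2, 3, 5], [2, 3, 9]]"

text \<open>
  Each entry leads from the previous surface to the next one by moves, and gives the positions of
  the vertices and the permutation of the vertices realized by the rotation
  \<open>(x, y, z) \<mapsto> (z, x, y)\<close> about the diagonal.
\<close>

definition realizations :: "((nat list \<times> nat list) list \<times> (int \<times> int \<times> int) list \<times> nat list) list" where
  "realizations =
    [([([4, 8], [0, 3]), ([7, 8], [1, 6]), ([0, 5], [7, 8]), ([4, 9], [0, 5]), ([1, 5], [4, 8]),
       ([1, 4], [8, 2]), ([6, 7], [1, 4])],
      [(3, -1, 2), (3, -1, 3), (0, 0, 0), (2, 3, -1), (-1, 2, 3), (-4, 4, 6), (-1, 3, 3),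
       (4, 6, -4), (6, -4, 4), (3, 3, -1)],
      [3, 9, 2, 4, 0, 8, 1, 5, 7, 6]),
     ([([1, 4], [6, 7]), ([3, 8], [0, 6]), ([0, 5], [4, 9]), ([0, 9], [1, 4]), ([3, 6], [0, 9]),
       ([4, 7], [3, 6]), ([6, 7], [1, 3])],
      [(-3, -3, 2), (-3, 1, -1), (0, 0, 0), (2, -3, -3), (-3, 2, -3), (1, -1, -2), (1, -1, -3),
       (-1, -2, 1), (-2, 1, -1), (-1, -3, 1)],
      [3, 9, 2, 4, 0, 8, 1, 5, 7, 6]),
     ([([6, 9], [0, 5]), ([1, 6], [3, 8]), ([1, 9], [4, 7])],
      [(3, -3, 4), (-3, 2, 4), (0, 0, 0), (4, 3, -3), (-3, 4, 3), (1, 2, -1), (2, 4, -3),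
       (2, -1, 1), (-1, 1, 2), (4, -3, 2)],
      [3, 9, 2, 4, 0, 8, 1, 5, 7, 6]),
     ([([0, 8], [6, 7]), ([3, 7], [1, 5]), ([4, 5], [8, 9])],
      [(-3, 2, 0), (1, 3, -1), (0, 0, 0), (0, -3, 2), (2, 0, -3), (1, 1, 0), (3, -1, 1), (1, 0, 1),
       (0, 1, 1), (-1, 1, 3)],
      [3, 9, 2, 4, 0, 8, 1, 5, 7, 6]),
     ([([5, 9], [0, 8]), ([1, 7], [4, 5]), ([6, 8], [3, 7])],
      [(-1, 1, 3), (0, -3, 2), (0, 0, 0), (1, 3, -1), (3, -1, 1), (0, 1, 1), (2, 0, -3), (1, 0, 1),
       (1, 1, 0), (-3, 2, 0)],
      [4, 6, 2, 0, 3, 7, 9, 8, 5, 1]),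
     ([([0, 5], [6, 8]), ([3, 8], [1, 7]), ([4, 7], [5, 9])],
      [(1, -3, -3), (-2, 1, -3), (0, 0, 0), (-3, -3, 1), (-3, 1, -3), (0, -2, -1), (-3, -2, 1),
       (-1, 0, -2), (-2, -1, 0), (1, -3, -2)],
      [4, 6, 2, 0, 3, 7, 9, 8, 5, 1]),
     ([([0, 8], [6, 9]), ([3, 7], [1, 6]), ([4, 5], [1, 9])],
      [(0, 0, 1), (3, -1, 0), (0, 0, 0), (0, 1, 0), (1, 0, 0), (-3, 3, 3), (0, 3, -1), (3, -3, 3),
       (3, 3, -3), (-1, 0, 3)],
      [4, 6, 2, 0, 3, 7, 9, 8, 5, 1]),
     ([([1, 2], [0, 8]), ([9, 2], [3, 7]), ([6, 2], [4, 5])],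
      [(9, 5, -5), (2, 5, 1), (0, 0, 0), (5, -5, 9), (-5, 9, 5), (4, -2, 5), (1, 2, 5), (5, 4, -2),
       (-2, 5, 4), (5, 1, 2)],
      [4, 6, 2, 0, 3, 7, 9, 8, 5, 1]),
     ([([4, 5], [6, 2]), ([3, 5], [1, 2]), ([1, 5], [9, 2]), ([7, 8], [1, 5]), ([0, 2], [7, 8])],
      [(1, -3, -4), (0, -1, 0), (-1, 4, -2), (-4, 1, -3), (-3, -4, 1), (0, 0, 0), (-1, 0, 0),
       (4, -2, -1), (-2, -1, 4), (0, 0, -1)],
      [3, 9, 8, 4, 0, 5, 1, 2, 7, 6]),
     ([([7, 8], [0, 2]), ([1, 5], [7, 8]), ([9, 2], [1, 5]), ([1, 2], [3, 5]), ([3, 7], [9, 2]),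
       ([0, 8], [1, 2]), ([1, 9], [4, 5]), ([1, 6], [3, 7]), ([6, 9], [0, 8]), ([5, 9], [4, 7]),
       ([1, 7], [3, 8]), ([6, 8], [0, 5]), ([0, 2], [1, 7]), ([5, 6], [0, 2]), ([4, 2], [6, 8]),
       ([3, 2], [5, 9]), ([1, 8], [3, 2]), ([7, 9], [4, 2])],
      [(1, -1, -3), (0, -1, -1), (0, 0, 0), (-1, -3, 1), (-3, 1, -1), (0, 3, -2), (-1, 0, -1),
       (-2, 0, 3), (3, -2, 0), (-1, -1, 0)],
      [4, 6, 2, 0, 3, 7, 9, 8, 5, 1])]"

section \<open>Checking the certificates\<close>

definition realized :: "nat list list \<Rightarrow> (nat \<Rightarrow> int \<times> int \<times> int) \<Rightarrow> (nat \<Rightarrow> nat) \<Rightarrow> bool" where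
  "realized ts P \<alpha> \<longleftrightarrow> ts \<noteq> [] \<and> (\<forall>t\<in>set ts. is_triangle t) \<and> distinct ts \<and>
     length (remdups (concat ts)) = 10 \<and> immersed ts P \<and> symmetric ts P \<alpha>"

fun realized_list :: "((nat list \<times> nat list) list \<times> (int \<times> int \<times> int) list \<times> nat list) list \<Rightarrow>
    nat list list \<Rightarrow> nat list list list option" where
  "realized_list [] ts = Some []"
| "realized_list ((ms, ps, as) # xs) ts = (case moves ms ts of None \<Rightarrow> None
     | Some us \<Rightarrow> if realized us ((!) ps) ((!) as) then map_option (Cons us) (realized_list xs us) else None)"

lemma realized_listD:
  assumes "realized_list xs ts = Some L" "nonorientable_surface h (polyhedron ts)" "us \<in> set L"
  shows "nonorientable_surface h (polyhedron us) \<and> (\<exists>P \<alpha>. realized us P \<alpha>)"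
  using assms
proof (induction xs ts arbitrary: L rule: realized_list.induct)
  case (2 ms ps as xs ts)
  obtain vs M where vs: "moves ms ts = Some vs" "realized vs ((!) ps) ((!) as)" "realized_list xs vs = Some M" "L = vs # M"
    using 2(2) by (auto split: option.splits if_splits)
  have "nonorientable_surface h (polyhedron vs)"
    using nonorientable_surface_homeomorphic[OF 2(3) moves_homeomorphic[OF vs(1)]] .
  then show ?case
    using 2(1)[OF vs(1-3)] 2(4) vs(2,4) by auto
qed simp

lemma hemi_octahedron_list: "set ` set hemi_octahedron_list = hemi_octahedron"
  by (auto simp: hemi_octahedron_list_def hemi_octahedron_def UNIV_bool xy_def xz_def yz_def)

text \<open>The three axes 0, 1, 2 have degree four. Flipping one edge at such a vertex leaves
  degree three, and the vertex can be removed.\<close>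

lemma moves_hemi_octahedron_list: "moves
    [([0, 4], [5, 6]), ([0], [3, 5, 6]), ([2, 5], [7, 8]), ([2], [6, 7, 8]), ([1, 7], [3, 4]), ([1], [3, 4, 8])]
    hemi_octahedron_list = Some projective_plane_list"
  by code_simp

text \<open>Each gluing adds three vertices, and the moves after it remove one, one, three and three
  of them: the surfaces with two to five crosscaps end up with 8, 10, 10 and 10 vertices.\<close>

lemma attach_crosscaps: "attach projective_plane_list crosscaps projective_plane_list = Some N5_list"
  by code_simp

text \<open>All moves here are edge flips, so the number of vertices stays ten. In the third to
  eighth entries they form one orbit of three flips under the symmetry; in general only the surface
  at the end of an entry is tested for symmetry and immersion. The \<open>case\<close> form avoids
  writing out the ten lists of triangles.\<close>

lemma realized_realizations:
  "case realized_list realizations N5_list of None \<Rightarrow> False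
   | Some L \<Rightarrow> length L = 10 \<and> distinct (map invariant_list L)"
  by code_simp

lemma nonorientable_surface_N5_list: "nonorientable_surface 5 (polyhedron N5_list)"
proof -
  have "projective_plane (polyhedron hemi_octahedron_list)"
    using projective_plane_hemi_octahedron by (simp add: spanned_def hemi_octahedron_list)
  then have P: "projective_plane (polyhedron projective_plane_list)"
    using projective_plane_homeomorphic moves_homeomorphic[OF moves_hemi_octahedron_list] by blast
  have "nonorientable_surface (1 + length crosscaps) (polyhedron N5_list)"
    using nonorientable_surface_attach[OF P attach_crosscaps nonorientable_surface.one[OF P]] .
  then show ?thesis by (simp add: crosscaps_def eval_nat_numeral)
qed

theorem theorem5p6:
  shows "(\<exists>T :: nat set set set.
            10 \<le> card T \<and>
            pairwise (\<lambda>K L. \<not> simplicially_isomorphic K L) T \<and>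
            (\<forall>K\<in>T. triangulation_of_N 5 K \<and> card (vertices K) = 10 \<and>
                   (\<exists>\<psi>. polyhedral_realization K \<psi>)))
       \<and> (\<exists>T :: nat set set set.
            10 \<le> card T \<and>
            pairwise (\<lambda>K L. \<not> simplicially_isomorphic K L) T \<and>
            (\<forall>K\<in>T. triangulation_of_N 5 K \<and> card (vertices K) = 10 \<and>
                   (\<exists>\<psi>. polyhedral_realization K \<psi> \<and> threefold_rotational_symmetry K \<psi>)))"
proof -
  obtain L where L: "realized_list realizations N5_list = Some L" "length L = 10" "distinct (map invariant_list L)"
    using realized_realizations by (auto split: option.splits)
  note surfaces = realized_listD[OF L(1) nonorientable_surface_N5_list]
  \<comment> \<open>The same ten complexes serve both halves of the theorem, as the symmetric
    realizations are in particular realizations.\<close>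
  define T where "T = spanned ` set L"
  have realization: "triangulation_of_N 5 (spanned ts) \<and> card (vertices (spanned ts)) = 10 \<and>
      (\<exists>\<psi>. polyhedral_realization (spanned ts) \<psi> \<and> threefold_rotational_symmetry (spanned ts) \<psi>) \<and>
      invariant (spanned ts) = invariant_list ts" if ts_L: "ts \<in> set L" for ts
  proof -
    obtain P \<alpha> where ts: "ts \<noteq> []" "\<forall>t\<in>set ts. is_triangle t" "distinct ts"
      "length (remdups (concat ts)) = 10" "immersed ts P" "symmetric ts P \<alpha>"
      using surfaces[OF ts_L] unfolding realized_def by blast
    have "card (vertices (spanned ts)) = 10"
      unfolding vertices_spanned using ts(4) by (simp only: length_remdups_card_conv)
    then show ?thesis
      using triangulation_of_N_spanned[OF _ ts(2,1)] surfaces[OF ts_L] invariant_spanned[OF ts(2,3)]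
        polyhedral_realization_immersed[OF ts(2,5)] threefold_rotational_symmetry_symmetric[OF ts(6)]
      by blast
  qed
  have inj: "inj_on invariant_list (set L)"
    using L(3) by (simp add: distinct_map)
  \<comment> \<open>An entry of L is determined by the invariant of its complex. This gives both
    that T has ten elements and that no two of them are isomorphic.\<close>
  have eq: "ts = us" if "ts \<in> set L" "us \<in> set L" "invariant (spanned ts) = invariant (spanned us)" for ts us
    using inj_onD[OF inj _ that(1,2)] realization[OF that(1)] realization[OF that(2)] that(3) by simp
  have "card T = 10"
  proof -
    have "inj_on spanned (set L)"
      by (rule inj_onI) (use eq in simp)
    moreover have "distinct L" using L(3) by (simp add: distinct_map)
    ultimately show ?thesis
      unfolding T_def using L(2) by (simp add: card_image distinct_card)
  qed
  moreover have "pairwise (\<lambda>K L. \<not> simplicially_isomorphic K L) T"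
    unfolding pairwise_def
  proof (intro ballI impI)
    fix K M assume KM: "K \<in> T" "M \<in> T" "K \<noteq> M"
    then obtain ts us where "ts \<in> set L" "us \<in> set L" "K = spanned ts" "M = spanned us"
      unfolding T_def by blast
    then show "\<not> simplicially_isomorphic K M"
      using eq[of ts us] invariant_simplicial_iso KM(3) unfolding simplicially_isomorphic_def by blast
  qed
  moreover have "\<forall>K\<in>T. triangulation_of_N 5 K \<and> card (vertices K) = 10 \<and>
      (\<exists>\<psi>. polyhedral_realization K \<psi> \<and> threefold_rotational_symmetry K \<psi>)"
    unfolding T_def using realization by blast
  ultimately show ?thesis
    by (intro conjI exI[of _ T]) auto
qed

end
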